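(* The full subcategory of $\mathbf{W}$ comprised of the pointwise $\sigma$-complete objects is reflective in $\mathbf{W}$.
   Context: $\mathbf{W}$ is the category of archimedean lattice-ordered groups $G$ with a designated weak order unit, written $1$ (so $1\ge 0$ and $g \wedge 1 = 0$ with $g \geq 0$ implies $g = 0$); morphisms are lattice-ordered group homomorphisms carrying designated unit to designated unit. An extension $G\le H$ is an injective $\mathbf{W}$-morphism, regarded as an inclusion. For $F\subseteq G$ and $f_0\in G$, $f_0$ is the pointwise supremum (pointwise join) of $F$ in $G$ if $\theta(f_0) = \bigvee \theta[F]$ in $H$ for every $\mathbf{W}$-morphism $\theta: G\to H$. A downset of $G$ is a subset $Z\subseteq G$ such that $g\le z\in Z$ implies $g\in Z$; it is countably generated if it has the form $\{g\in G: g\le k\text{ for some }k\in K\}$ for a countable $K\subseteq G$. A downset is a cut if it has a supremum in some extension of $G$ (in $\mathbf{W}$). A $\mathbf{W}$-object $G$ is pointwise $\sigma$-complete if it is divisible and every countably generated cut in $G$ has a pointwise join in $G$. *)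

theory Defs
  imports "HOL-Algebra.Group" "HOL-Library.Countable_Set" "HOL-Library.FuncSet"
begin

section \<open>The category W\<close>

text \<open>Lattice-ordered groups are written additively. The group reduct is the \<^typ>\<open>'a monoid\<close>
  \<open>add_grp G\<close>, so \<open>x [^]\<^bsub>add_grp G\<^esub> n\<close> is the multiple of \<open>x\<close> by the natural number \<open>n\<close>.\<close>

record 'a wstruct = "'a gorder" +
  wadd :: "'a \<Rightarrow> 'a \<Rightarrow> 'a"
  wzero :: "'a"
  wunit :: "'a"

abbreviation add_grp :: "'a wstruct \<Rightarrow> 'a monoid" where
  "add_grp G \<equiv> \<lparr>carrier = carrier G, monoid.mult = wadd G, one = wzero G\<rparr>"

text \<open>As usual for additively written groups, commutativity is part of the definition (an
  archimedean lattice-ordered group is commutative in any case). The trivial group, with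
  designated unit 0, is an object.\<close>

locale W_object = Lattice.lattice G for G :: "'a wstruct" (structure) +
  assumes add_group: "comm_group (add_grp G)"
    and add_mono: "\<lbrakk>x \<in> carrier G; y \<in> carrier G; z \<in> carrier G; x \<sqsubseteq> y\<rbrakk>
          \<Longrightarrow> wadd G x z \<sqsubseteq> wadd G y z"
    and archimedean: "\<lbrakk>x \<in> carrier G; y \<in> carrier G; wzero G \<sqsubseteq> x;
          \<And>n::nat. x [^]\<^bsub>add_grp G\<^esub> n \<sqsubseteq> y\<rbrakk> \<Longrightarrow> x = wzero G"
    and unit_closed: "wunit G \<in> carrier G"
    and unit_nonneg: "wzero G \<sqsubseteq> wunit G"
    and weak_unit: "\<lbrakk>x \<in> carrier G; wzero G \<sqsubseteq> x; x \<sqinter> wunit G = wzero G\<rbrakk> \<Longrightarrow> x = wzero G"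

text \<open>Morphisms are extensional functions, so that equality of morphisms is equality in HOL and
  composition is \<^const>\<open>compose\<close>.\<close>

definition W_hom :: "'a wstruct \<Rightarrow> 'b wstruct \<Rightarrow> ('a \<Rightarrow> 'b) set" where
  "W_hom G H = {\<theta> \<in> hom (add_grp G) (add_grp H) \<inter> extensional (carrier G).
     (\<forall>x\<in>carrier G. \<forall>y\<in>carrier G. \<theta> (x \<squnion>\<^bsub>G\<^esub> y) = \<theta> x \<squnion>\<^bsub>H\<^esub> \<theta> y \<and> \<theta> (x \<sqinter>\<^bsub>G\<^esub> y) = \<theta> x \<sqinter>\<^bsub>H\<^esub> \<theta> y) \<and>
     \<theta> (wunit G) = wunit H}"

definition W_extension :: "'a wstruct \<Rightarrow> 'b wstruct \<Rightarrow> ('a \<Rightarrow> 'b) \<Rightarrow> bool" where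
  "W_extension G H \<theta> \<longleftrightarrow> W_object H \<and> \<theta> \<in> W_hom G H \<and> inj_on \<theta> (carrier G)"


section \<open>Pointwise joins, cuts and pointwise \<open>\<sigma>\<close>-completeness\<close>

text \<open>A definition cannot quantify over types, so in the next definition and in that of cuts the
  object \<open>H\<close> ranges over the W-objects with carrier in the type of \<open>G\<close>. This loses nothing:
  \<open>pointwise_join_is_lub\<close> and \<open>cut_if_is_lub_extension\<close> below extend both notions to
  W-objects \<open>H\<close> over an arbitrary type.\<close>

definition pointwise_join :: "'a wstruct \<Rightarrow> 'a \<Rightarrow> 'a set \<Rightarrow> bool" where
  "pointwise_join G f F \<longleftrightarrow> f \<in> carrier G \<and> F \<subseteq> carrier G \<and>
     (\<forall>(H :: 'a wstruct) \<theta>. W_object H \<longrightarrow> \<theta> \<in> W_hom G H \<longrightarrow> is_lub H (\<theta> f) (\<theta> ` F))"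

definition downset :: "'a wstruct \<Rightarrow> 'a set \<Rightarrow> bool" where
  "downset G Z \<longleftrightarrow> Z \<subseteq> carrier G \<and> (\<forall>z\<in>Z. \<forall>g\<in>carrier G. g \<sqsubseteq>\<^bsub>G\<^esub> z \<longrightarrow> g \<in> Z)"

definition countably_generated :: "'a wstruct \<Rightarrow> 'a set \<Rightarrow> bool" where
  "countably_generated G Z \<longleftrightarrow>
     (\<exists>K. countable K \<and> K \<subseteq> carrier G \<and> Z = {g \<in> carrier G. \<exists>k\<in>K. g \<sqsubseteq>\<^bsub>G\<^esub> k})"

definition cut :: "'a wstruct \<Rightarrow> 'a set \<Rightarrow> bool" where
  "cut G Z \<longleftrightarrow> downset G Z \<and>
     (\<exists>(H :: 'a wstruct) \<theta> s. W_extension G H \<theta> \<and> is_lub H s (\<theta> ` Z))"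

definition divisible :: "'a wstruct \<Rightarrow> bool" where
  "divisible G \<longleftrightarrow>
     (\<forall>g\<in>carrier G. \<forall>n::nat. 0 < n \<longrightarrow> (\<exists>x\<in>carrier G. x [^]\<^bsub>add_grp G\<^esub> n = g))"

definition pointwise_sigma_complete :: "'a wstruct \<Rightarrow> bool" where
  "pointwise_sigma_complete G \<longleftrightarrow> W_object G \<and> divisible G \<and>
     (\<forall>Z. countably_generated G Z \<and> cut G Z \<longrightarrow> (\<exists>f. pointwise_join G f Z))"


section \<open>Reflections\<close>

text \<open>\<open>is_reflection TYPE('h) G R r\<close>: the morphism \<open>r: G \<rightarrow> R\<close> is a reflection of \<open>G\<close> in the full
  subcategory of pointwise \<open>\<sigma>\<close>-complete objects, with the universal property tested against the
  objects over \<^typ>\<open>'h\<close>. When \<^typ>\<open>'h\<close> is the carrier type of \<open>R\<close>, this determines \<open>(R, r)\<close> up to a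
  unique isomorphism; so if such a pair is also a reflection for an arbitrary further type, then it
  is the reflection of \<open>G\<close> in the category of all W-objects.\<close>

definition is_reflection ::
    "'h itself \<Rightarrow> 'a wstruct \<Rightarrow> 'r wstruct \<Rightarrow> ('a \<Rightarrow> 'r) \<Rightarrow> bool" where
  "is_reflection _ G R r \<longleftrightarrow> pointwise_sigma_complete R \<and> r \<in> W_hom G R \<and>
     (\<forall>H :: 'h wstruct. pointwise_sigma_complete H \<longrightarrow>
        (\<forall>f\<in>W_hom G H. \<exists>!g. g \<in> W_hom R H \<and> compose (carrier G) g r = f))"


section \<open>Independence of the type over which the test objects range\<close>

lemma lub_pair_join:
  assumes "Lattice.lattice L" "is_lub L s {x, y}" "x \<in> carrier L" "y \<in> carrier L"
  shows "x \<squnion>\<^bsub>L\<^esub> y = s"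
proof -
  interpret Lattice.lattice L by fact
  have "is_lub L (x \<squnion>\<^bsub>L\<^esub> y) {x, y}"
    unfolding join_def by (rule sup_of_two_least) (use assms in auto)
  then show ?thesis using assms(2) least_unique by blast
qed

lemma glb_pair_meet:
  assumes "Lattice.lattice L" "is_glb L s {x, y}" "x \<in> carrier L" "y \<in> carrier L"
  shows "x \<sqinter>\<^bsub>L\<^esub> y = s"
proof -
  interpret Lattice.lattice L by fact
  have "is_glb L (x \<sqinter>\<^bsub>L\<^esub> y) {x, y}"
    unfolding meet_def by (rule inf_of_two_greatest) (use assms in auto)
  then show ?thesis using assms(2) greatest_unique by blast
qed

lemma W_hom_closed: "\<theta> \<in> W_hom G H \<Longrightarrow> x \<in> carrier G \<Longrightarrow> \<theta> x \<in> carrier H"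
  by (auto simp: W_hom_def hom_def)

lemma W_hom_mono:
  assumes "W_object G" "W_object H" "\<theta> \<in> W_hom G H" "x \<in> carrier G" "y \<in> carrier G" "x \<sqsubseteq>\<^bsub>G\<^esub> y"
  shows "\<theta> x \<sqsubseteq>\<^bsub>H\<^esub> \<theta> y"
proof -
  interpret G: W_object G by fact
  interpret H: W_object H by fact
  have "x \<squnion>\<^bsub>G\<^esub> y = y"
    using assms G.le_iff_meet[of x y] by simp
  moreover have "\<theta> (x \<squnion>\<^bsub>G\<^esub> y) = \<theta> x \<squnion>\<^bsub>H\<^esub> \<theta> y"
    using assms(3-5) by (simp add: W_hom_def)
  ultimately have "\<theta> x \<squnion>\<^bsub>H\<^esub> \<theta> y = \<theta> y"
    by simp
  then show ?thesis
    using assms H.le_iff_meet[of "\<theta> x" "\<theta> y"] W_hom_closed[OF assms(3)] by simp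
qed

lemma W_hom_zero:
  assumes "W_object G" "W_object H" "\<theta> \<in> W_hom G H"
  shows "\<theta> (wzero G) = wzero H"
proof -
  interpret G: comm_group "add_grp G" using assms by (simp add: W_object.add_group)
  interpret H: comm_group "add_grp H" using assms by (simp add: W_object.add_group)
  have "\<theta> \<in> hom (add_grp G) (add_grp H)"
    using assms by (simp add: W_hom_def)
  from hom_one[OF this G.is_group H.is_group] show ?thesis by simp
qed

lemma W_hom_id:
  assumes "W_object G"
  shows "restrict id (carrier G) \<in> W_hom G G"
proof -
  interpret G: W_object G by fact
  interpret g: comm_group "add_grp G" by (rule G.add_group)
  show ?thesis
    using g.m_closed G.unit_closed by (auto simp: W_hom_def hom_def)
qed

lemma W_object_trivial_or_infinite:
  assumes "W_object G"
  shows "carrier G = {wzero G} \<or> infinite (carrier G)"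
proof (rule disjCI)
  assume "\<not> infinite (carrier G)"
  then have fin: "finite (carrier G)" by simp
  interpret G: W_object G by fact
  interpret g: comm_group "add_grp G" by (rule G.add_group)
  have z: "wzero G \<in> carrier G" using g.one_closed by simp
  define u where "u = \<Squnion>\<^bsub>G\<^esub> carrier G"
  have "is_lub G u (carrier G)"
    unfolding u_def using fin z by (intro G.finite_sup_least) auto
  then have u: "u \<in> carrier G" "\<And>x. x \<in> carrier G \<Longrightarrow> x \<sqsubseteq>\<^bsub>G\<^esub> u"
    by (auto simp: least_def Upper_def)
  have pos: "x = wzero G" if "x \<in> carrier G" "wzero G \<sqsubseteq>\<^bsub>G\<^esub> x" for x
    using G.archimedean[OF that(1) u(1) that(2)] u(2) g.nat_pow_closed that(1) by simp
  have "x = wzero G" if x: "x \<in> carrier G" for x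
  proof -
    have nonpos: "y \<sqsubseteq>\<^bsub>G\<^esub> wzero G" if y: "y \<in> carrier G" for y
    proof -
      have "y \<squnion>\<^bsub>G\<^esub> wzero G = wzero G"
        using y z by (intro pos G.join_closed G.join_right)
      then show ?thesis using G.join_left[OF y z] by simp
    qed
    define y where "y = inv\<^bsub>add_grp G\<^esub> x"
    have y: "y \<in> carrier G" "wadd G y x = wzero G"
      using g.inv_closed[of x] g.l_inv[of x] x by (simp_all add: y_def)
    have "wadd G y x \<sqsubseteq>\<^bsub>G\<^esub> wadd G (wzero G) x"
      using y x z by (intro G.add_mono nonpos)
    then have "wzero G \<sqsubseteq>\<^bsub>G\<^esub> x"
      using y x g.l_one[of x] by simp
    then show ?thesis using pos x by blast
  qed
  then show "carrier G = {wzero G}" using z by blast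
qed

definition W_closed :: "'a wstruct \<Rightarrow> 'a set \<Rightarrow> bool" where
  "W_closed H K \<longleftrightarrow> K \<subseteq> carrier H \<and> wzero H \<in> K \<and> wunit H \<in> K \<and>
     (\<forall>x\<in>K. inv\<^bsub>add_grp H\<^esub> x \<in> K) \<and>
     (\<forall>x\<in>K. \<forall>y\<in>K. wadd H x y \<in> K \<and> x \<squnion>\<^bsub>H\<^esub> y \<in> K \<and> x \<sqinter>\<^bsub>H\<^esub> y \<in> K)"

text \<open>The copy of the subobject \<open>K\<close> of \<open>H\<close> along the injection \<open>e\<close>.\<close>

definition W_copy :: "'b wstruct \<Rightarrow> 'b set \<Rightarrow> ('b \<Rightarrow> 'a) \<Rightarrow> 'a wstruct" where
  "W_copy H K e = (let d = inv_into K e in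
     \<lparr>carrier = e ` K, eq = (=), le = (\<lambda>x y. d x \<sqsubseteq>\<^bsub>H\<^esub> d y),
      wadd = (\<lambda>x y. e (wadd H (d x) (d y))), wzero = e (wzero H), wunit = e (wunit H)\<rparr>)"

context
  fixes H :: "'b wstruct" and K :: "'b set" and e :: "'b \<Rightarrow> 'a"
  assumes H: "W_object H" and K: "W_closed H K" and e: "inj_on e K"
begin

interpretation H: W_object H by (rule H)
interpretation h: comm_group "add_grp H" by (rule H.add_group)

lemma W_closed_carrier: "x \<in> K \<Longrightarrow> x \<in> carrier H"
  using K by (auto simp: W_closed_def)

lemma copy_carrier: "carrier (W_copy H K e) = e ` K"
  by (simp add: W_copy_def Let_def)

lemma copy_le: "x \<in> K \<Longrightarrow> y \<in> K \<Longrightarrow> e x \<sqsubseteq>\<^bsub>W_copy H K e\<^esub> e y \<longleftrightarrow> x \<sqsubseteq>\<^bsub>H\<^esub> y"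
  using e by (simp add: W_copy_def Let_def)

lemma copy_add: "x \<in> K \<Longrightarrow> y \<in> K \<Longrightarrow> wadd (W_copy H K e) (e x) (e y) = e (wadd H x y)"
  using e by (simp add: W_copy_def Let_def)

lemma copy_zero: "wzero (W_copy H K e) = e (wzero H)" and copy_unit: "wunit (W_copy H K e) = e (wunit H)"
  by (simp_all add: W_copy_def Let_def)

lemma copy_is_lubI:
  assumes "A \<subseteq> K" "s \<in> K" "is_lub H s A"
  shows "is_lub (W_copy H K e) (e s) (e ` A)"
  unfolding least_def
proof (intro conjI ballI)
  show "e s \<in> Upper (W_copy H K e) (e ` A)"
  proof -
    have "x \<sqsubseteq>\<^bsub>H\<^esub> s" if "x \<in> A" for x
      using assms(3) that assms(1) W_closed_carrier[of x] by (auto simp: least_def Upper_def)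
    then have "e x \<sqsubseteq>\<^bsub>W_copy H K e\<^esub> e s" if "x \<in> A" for x
      using that assms(1,2) copy_le[of x s] by auto
    then show ?thesis using assms(2) by (auto simp: Upper_def copy_carrier)
  qed
next
  fix u assume u: "u \<in> Upper (W_copy H K e) (e ` A)"
  then obtain b where b: "b \<in> K" "u = e b" by (auto simp: Upper_def copy_carrier)
  have "x \<sqsubseteq>\<^bsub>H\<^esub> b" if "x \<in> A" for x
    using u b that assms(1) copy_le[of x b] by (auto simp: Upper_def copy_carrier)
  then have "s \<sqsubseteq>\<^bsub>H\<^esub> b"
    using assms(3) b W_closed_carrier by (auto simp: least_def Upper_def)
  then show "e s \<sqsubseteq>\<^bsub>W_copy H K e\<^esub> u" using b assms(2) by (simp add: copy_le)
qed (simp add: Upper_closed)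

lemma copy_is_glbI:
  assumes "A \<subseteq> K" "s \<in> K" "is_glb H s A"
  shows "is_glb (W_copy H K e) (e s) (e ` A)"
  unfolding greatest_def
proof (intro conjI ballI)
  show "e s \<in> Lower (W_copy H K e) (e ` A)"
  proof -
    have "s \<sqsubseteq>\<^bsub>H\<^esub> x" if "x \<in> A" for x
      using assms(3) that assms(1) W_closed_carrier[of x] by (auto simp: greatest_def Lower_def)
    then have "e s \<sqsubseteq>\<^bsub>W_copy H K e\<^esub> e x" if "x \<in> A" for x
      using that assms(1,2) copy_le[of s x] by auto
    then show ?thesis using assms(2) by (auto simp: Lower_def copy_carrier)
  qed
next
  fix u assume u: "u \<in> Lower (W_copy H K e) (e ` A)"
  then obtain b where b: "b \<in> K" "u = e b" by (auto simp: Lower_def copy_carrier)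
  have "b \<sqsubseteq>\<^bsub>H\<^esub> x" if "x \<in> A" for x
    using u b that assms(1) copy_le[of b x] by (auto simp: Lower_def copy_carrier)
  then have "b \<sqsubseteq>\<^bsub>H\<^esub> s"
    using assms(3) b W_closed_carrier by (auto simp: greatest_def Lower_def)
  then show "u \<sqsubseteq>\<^bsub>W_copy H K e\<^esub> e s" using b assms(2) by (simp add: copy_le)
qed (simp add: Lower_closed)

lemma copy_partial_order: "partial_order (W_copy H K e)"
proof -
  have eq: "(.=\<^bsub>W_copy H K e\<^esub>) = (=)" by (simp add: W_copy_def Let_def)
  show ?thesis
  proof
    fix x y assume "x \<sqsubseteq>\<^bsub>W_copy H K e\<^esub> y" "y \<sqsubseteq>\<^bsub>W_copy H K e\<^esub> x"
      "x \<in> carrier (W_copy H K e)" "y \<in> carrier (W_copy H K e)"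
    then obtain a b where "a \<in> K" "x = e a" "b \<in> K" "y = e b" "a \<sqsubseteq>\<^bsub>H\<^esub> b" "b \<sqsubseteq>\<^bsub>H\<^esub> a"
      by (auto simp: copy_carrier copy_le)
    then have "a = b" using H.le_antisym W_closed_carrier by blast
    then show "x .=\<^bsub>W_copy H K e\<^esub> y" using \<open>x = e a\<close> \<open>y = e b\<close> by (simp add: eq)
  next
    fix x y z assume "x \<sqsubseteq>\<^bsub>W_copy H K e\<^esub> y" "y \<sqsubseteq>\<^bsub>W_copy H K e\<^esub> z"
      "x \<in> carrier (W_copy H K e)" "y \<in> carrier (W_copy H K e)" "z \<in> carrier (W_copy H K e)"
    then show "x \<sqsubseteq>\<^bsub>W_copy H K e\<^esub> z"
      using H.le_trans W_closed_carrier by (auto simp: copy_carrier copy_le)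
  qed (auto simp: eq copy_carrier copy_le W_closed_carrier)
qed

lemma copy_lub_two:
  assumes "x \<in> K" "y \<in> K"
  shows "is_lub (W_copy H K e) (e (x \<squnion>\<^bsub>H\<^esub> y)) {e x, e y}"
proof -
  have "is_lub H (x \<squnion>\<^bsub>H\<^esub> y) {x, y}"
    unfolding join_def by (rule H.sup_of_two_least) (use assms W_closed_carrier in auto)
  then show ?thesis
    using copy_is_lubI[of "{x, y}"] assms K by (auto simp: W_closed_def)
qed

lemma copy_glb_two:
  assumes "x \<in> K" "y \<in> K"
  shows "is_glb (W_copy H K e) (e (x \<sqinter>\<^bsub>H\<^esub> y)) {e x, e y}"
proof -
  have "is_glb H (x \<sqinter>\<^bsub>H\<^esub> y) {x, y}"
    unfolding meet_def by (rule H.inf_of_two_greatest) (use assms W_closed_carrier in auto)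
  then show ?thesis
    using copy_is_glbI[of "{x, y}"] assms K by (auto simp: W_closed_def)
qed

lemma copy_lattice: "Lattice.lattice (W_copy H K e)"
proof -
  interpret partial_order "W_copy H K e" by (rule copy_partial_order)
  show ?thesis
    by unfold_locales (auto simp: copy_carrier intro: copy_lub_two copy_glb_two)
qed

lemma copy_join: "x \<in> K \<Longrightarrow> y \<in> K \<Longrightarrow> e x \<squnion>\<^bsub>W_copy H K e\<^esub> e y = e (x \<squnion>\<^bsub>H\<^esub> y)"
  by (rule lub_pair_join[OF copy_lattice copy_lub_two]) (auto simp: copy_carrier)

lemma copy_meet: "x \<in> K \<Longrightarrow> y \<in> K \<Longrightarrow> e x \<sqinter>\<^bsub>W_copy H K e\<^esub> e y = e (x \<sqinter>\<^bsub>H\<^esub> y)"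
  by (rule glb_pair_meet[OF copy_lattice copy_glb_two]) (auto simp: copy_carrier)

lemma copy_group: "comm_group (add_grp (W_copy H K e))"
proof (rule comm_groupI)
  fix x assume "x \<in> carrier (add_grp (W_copy H K e))"
  then obtain a where a: "a \<in> K" "x = e a" by (auto simp: copy_carrier)
  have "inv\<^bsub>add_grp H\<^esub> a \<in> K" using a K by (auto simp: W_closed_def)
  moreover have "wadd H (inv\<^bsub>add_grp H\<^esub> a) a = wzero H"
    using h.l_inv[of a] a W_closed_carrier by simp
  ultimately show "\<exists>y\<in>carrier (add_grp (W_copy H K e)). y \<otimes>\<^bsub>add_grp (W_copy H K e)\<^esub> x = \<one>\<^bsub>add_grp (W_copy H K e)\<^esub>"
    using a by (auto simp: copy_carrier copy_zero copy_add intro!: bexI[of _ "inv\<^bsub>add_grp H\<^esub> a"])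
next
  fix x y z assume "x \<in> carrier (add_grp (W_copy H K e))" "y \<in> carrier (add_grp (W_copy H K e))" "z \<in> carrier (add_grp (W_copy H K e))"
  then obtain a b c where "a \<in> K" "x = e a" "b \<in> K" "y = e b" "c \<in> K" "z = e c"
    by (auto simp: copy_carrier)
  then show "x \<otimes>\<^bsub>add_grp (W_copy H K e)\<^esub> y \<otimes>\<^bsub>add_grp (W_copy H K e)\<^esub> z = x \<otimes>\<^bsub>add_grp (W_copy H K e)\<^esub> (y \<otimes>\<^bsub>add_grp (W_copy H K e)\<^esub> z)"
    using h.m_assoc[of a b c] K W_closed_carrier by (simp add: copy_add W_closed_def)
next
  fix x y assume "x \<in> carrier (add_grp (W_copy H K e))" "y \<in> carrier (add_grp (W_copy H K e))"
  then obtain a b where ab: "a \<in> K" "x = e a" "b \<in> K" "y = e b"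
    by (auto simp: copy_carrier)
  then show "x \<otimes>\<^bsub>add_grp (W_copy H K e)\<^esub> y = y \<otimes>\<^bsub>add_grp (W_copy H K e)\<^esub> x"
    using h.m_comm[of a b] W_closed_carrier by (simp add: copy_add)
  show "x \<otimes>\<^bsub>add_grp (W_copy H K e)\<^esub> y \<in> carrier (add_grp (W_copy H K e))"
    using ab K by (simp add: copy_add copy_carrier W_closed_def)
next
  show "\<one>\<^bsub>add_grp (W_copy H K e)\<^esub> \<in> carrier (add_grp (W_copy H K e))"
    using K by (simp add: copy_zero copy_carrier W_closed_def)
next
  fix x assume "x \<in> carrier (add_grp (W_copy H K e))"
  then obtain a where a: "a \<in> K" "x = e a" by (auto simp: copy_carrier)
  then show "\<one>\<^bsub>add_grp (W_copy H K e)\<^esub> \<otimes>\<^bsub>add_grp (W_copy H K e)\<^esub> x = x"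
    using h.l_one[of a] K W_closed_carrier by (simp add: copy_add copy_zero W_closed_def)
qed

lemma copy_pow:
  assumes "x \<in> K"
  shows "x [^]\<^bsub>add_grp H\<^esub> (n::nat) \<in> K \<and> e x [^]\<^bsub>add_grp (W_copy H K e)\<^esub> n = e (x [^]\<^bsub>add_grp H\<^esub> n)"
proof (induction n)
  case 0
  then show ?case using K by (simp add: copy_zero W_closed_def)
next
  case (Suc n)
  then show ?case using K assms by (simp add: copy_add W_closed_def)
qed

lemma W_object_copy: "W_object (W_copy H K e)"
proof -
  have z: "wzero H \<in> K" and u: "wunit H \<in> K" using K by (auto simp: W_closed_def)
  show ?thesis
  proof (intro W_object.intro W_object_axioms.intro)
    show "Lattice.lattice (W_copy H K e)" by (rule copy_lattice)
    show "comm_group (add_grp (W_copy H K e))" by (rule copy_group)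
  next
    fix x y z assume "x \<in> carrier (W_copy H K e)" "y \<in> carrier (W_copy H K e)" "z \<in> carrier (W_copy H K e)" "x \<sqsubseteq>\<^bsub>W_copy H K e\<^esub> y"
    then show "wadd (W_copy H K e) x z \<sqsubseteq>\<^bsub>W_copy H K e\<^esub> wadd (W_copy H K e) y z"
      using K W_closed_carrier H.add_mono by (auto simp: copy_carrier copy_le copy_add W_closed_def)
  next
    fix x y assume "x \<in> carrier (W_copy H K e)" "y \<in> carrier (W_copy H K e)" "wzero (W_copy H K e) \<sqsubseteq>\<^bsub>W_copy H K e\<^esub> x"
      and le: "\<And>n::nat. x [^]\<^bsub>add_grp (W_copy H K e)\<^esub> n \<sqsubseteq>\<^bsub>W_copy H K e\<^esub> y"
    then obtain a b where ab: "a \<in> K" "x = e a" "b \<in> K" "y = e b" "wzero H \<sqsubseteq>\<^bsub>H\<^esub> a"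
      using z by (auto simp: copy_carrier copy_zero copy_le)
    have "a [^]\<^bsub>add_grp H\<^esub> n \<sqsubseteq>\<^bsub>H\<^esub> b" for n :: nat
      using le[of n] ab copy_pow[of a n] by (simp add: copy_le)
    then have "a = wzero H"
      using H.archimedean ab W_closed_carrier by blast
    then show "x = wzero (W_copy H K e)" using ab by (simp add: copy_zero)
  next
    show "wunit (W_copy H K e) \<in> carrier (W_copy H K e)" using u by (simp add: copy_unit copy_carrier)
    show "wzero (W_copy H K e) \<sqsubseteq>\<^bsub>W_copy H K e\<^esub> wunit (W_copy H K e)"
      using z u H.unit_nonneg by (simp add: copy_unit copy_zero copy_le)
  next
    fix x assume "x \<in> carrier (W_copy H K e)" "wzero (W_copy H K e) \<sqsubseteq>\<^bsub>W_copy H K e\<^esub> x" and m: "x \<sqinter>\<^bsub>W_copy H K e\<^esub> wunit (W_copy H K e) = wzero (W_copy H K e)"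
    then obtain a where a: "a \<in> K" "x = e a" "wzero H \<sqsubseteq>\<^bsub>H\<^esub> a"
      using z by (auto simp: copy_carrier copy_zero copy_le)
    have "e (a \<sqinter>\<^bsub>H\<^esub> wunit H) = e (wzero H)"
      using m a u by (simp add: copy_meet copy_unit copy_zero)
    then have "a \<sqinter>\<^bsub>H\<^esub> wunit H = wzero H"
      using a u z K e by (auto simp: W_closed_def inj_on_def)
    then have "a = wzero H" using H.weak_unit a W_closed_carrier by blast
    then show "x = wzero (W_copy H K e)" using a by (simp add: copy_zero)
  qed
qed

lemma W_hom_copy:
  assumes "W_object G" "\<theta> \<in> W_hom G H" "\<theta> ` carrier G \<subseteq> K"
  shows "compose (carrier G) e \<theta> \<in> W_hom G (W_copy H K e)"
proof -
  interpret G: W_object G by fact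
  interpret g: comm_group "add_grp G" by (rule G.add_group)
  have "\<theta> x \<in> K" if "x \<in> carrier G" for x using that assms by blast
  moreover have "wadd G x y \<in> carrier G" if "x \<in> carrier G" "y \<in> carrier G" for x y
    using g.m_closed[of x y] that by simp
  ultimately show ?thesis
    using assms(2) G.unit_closed
    by (auto simp: W_hom_def hom_def compose_def copy_carrier copy_add copy_join copy_meet copy_unit)
qed

end

primrec W_gen :: "'b wstruct \<Rightarrow> 'b set \<Rightarrow> nat \<Rightarrow> 'b set" where
  "W_gen H S 0 = S"
| "W_gen H S (Suc n) = (let T = W_gen H S n in
     (T \<union> (\<lambda>x. inv\<^bsub>add_grp H\<^esub> x) ` T) \<union> (\<lambda>(x, y). wadd H x y) ` (T \<times> T) \<union>
     (\<lambda>(x, y). x \<squnion>\<^bsub>H\<^esub> y) ` (T \<times> T) \<union> (\<lambda>(x, y). x \<sqinter>\<^bsub>H\<^esub> y) ` (T \<times> T))"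

context
  includes cardinal_syntax
begin

lemma card_leq_Un:
  assumes "infinite A" "|X| \<le>o |A|" "|Y| \<le>o |A|"
  shows "|X \<union> Y| \<le>o |A|"
  using card_of_Un_ordLeq_infinite_Field[of "|A|" X Y] assms
  by (simp add: card_of_card_order_on Field_card_of)

lemma card_leq_image:
  assumes "|X| \<le>o |A|"
  shows "|f ` X| \<le>o |A|"
  using card_of_image assms ordLeq_transitive by blast

lemma card_leq_Times:
  assumes "infinite A" "|X| \<le>o |A|"
  shows "|X \<times> X| \<le>o |A|"
  using card_of_Times_ordLeq_infinite_Field[of "|A|" X X] assms
  by (simp add: card_of_card_order_on Field_card_of)

lemma W_gen_card:
  assumes "infinite A" "|S| \<le>o |A|"
  shows "|W_gen H S n| \<le>o |A|"
proof (induction n)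
  case 0
  then show ?case using assms by simp
next
  case (Suc n)
  then show ?case
    unfolding W_gen.simps Let_def
    by (intro card_leq_Un card_leq_image card_leq_Times assms(1)) auto
qed

lemma small_subobject:
  fixes G :: "'a wstruct" and H :: "'b wstruct"
  assumes G: "W_object G" and H: "W_object H" and \<theta>: "\<theta> \<in> W_hom G H" and h: "h \<in> carrier H"
  obtains K and e :: "'b \<Rightarrow> 'a" where "W_closed H K" "\<theta> ` carrier G \<subseteq> K" "h \<in> K" "inj_on e K"
proof -
  interpret G: W_object G by (rule G)
  interpret g: comm_group "add_grp G" by (rule G.add_group)
  interpret H: W_object H by (rule H)
  interpret h: comm_group "add_grp H" by (rule H.add_group)
  have z: "wzero H \<in> \<theta> ` carrier G"
  proof
    show "wzero H = \<theta> (wzero G)" using W_hom_zero[OF G H \<theta>] by simp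
    show "wzero G \<in> carrier G" using g.one_closed by simp
  qed
  have u: "wunit H \<in> \<theta> ` carrier G"
  proof
    show "wunit H = \<theta> (wunit G)" using \<theta> by (simp add: W_hom_def)
  qed (rule G.unit_closed)
  have sub: "\<theta> ` carrier G \<subseteq> carrier H"
    using W_hom_closed[OF \<theta>] by blast
  have hcl: "wzero H \<in> carrier H" "\<And>x. x \<in> carrier H \<Longrightarrow> inv\<^bsub>add_grp H\<^esub> x \<in> carrier H"
    "\<And>x y. x \<in> carrier H \<Longrightarrow> y \<in> carrier H \<Longrightarrow> wadd H x y \<in> carrier H"
    using h.one_closed h.inv_closed h.m_closed by auto
  consider "carrier G = {wzero G}" | "infinite (carrier G)"
    using W_object_trivial_or_infinite[OF G] by blast
  then show thesis
  proof cases
    case 1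
    then have "wunit G = wzero G" using G.unit_closed by simp
    then have "wunit H = wzero H" using W_hom_zero[OF G H \<theta>] \<theta> by (auto simp: W_hom_def)
    have le: "x \<sqsubseteq>\<^bsub>H\<^esub> wzero H" if x: "x \<in> carrier H" for x
    proof -
      define p where "p = x \<squnion>\<^bsub>H\<^esub> wzero H"
      have p: "p \<in> carrier H" "wzero H \<sqsubseteq>\<^bsub>H\<^esub> p" "x \<sqsubseteq>\<^bsub>H\<^esub> p"
        using x hcl(1) by (simp_all add: p_def H.join_left H.join_right)
      have "wzero H \<sqinter>\<^bsub>H\<^esub> p = wzero H"
        using p hcl(1) H.le_iff_join[of "wzero H" p] by simp
      moreover have "p \<sqinter>\<^bsub>H\<^esub> wzero H = wzero H \<sqinter>\<^bsub>H\<^esub> p"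
        by (simp add: meet_def insert_commute)
      ultimately have "p = wzero H"
        using H.weak_unit[of p] p \<open>wunit H = wzero H\<close> by simp
      then show ?thesis using p by simp
    qed
    have "x = wzero H" if x: "x \<in> carrier H" for x
    proof (rule H.le_antisym[OF le[OF x] _ x hcl(1)])
      have "wadd H (inv\<^bsub>add_grp H\<^esub> x) x \<sqsubseteq>\<^bsub>H\<^esub> wadd H (wzero H) x"
        using x hcl by (intro H.add_mono le) auto
      then show "wzero H \<sqsubseteq>\<^bsub>H\<^esub> x"
        using h.l_inv[of x] h.l_one[of x] x by simp
    qed
    then have "carrier H = {wzero H}" using hcl(1) by blast
    moreover have "W_closed H (carrier H)"
      using hcl H.unit_closed by (simp add: W_closed_def)
    ultimately show thesis
      using that[of "carrier H" "\<lambda>_. wzero G"] sub h by auto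
  next
    case 2
    define S where "S = insert h (\<theta> ` carrier G)"
    define K where "K = (\<Union>n. W_gen H S n)"
    have "|{h}| \<le>o |carrier G|"
      using 2 by (intro card_of_singl_ordLeq) auto
    then have "|S| \<le>o |carrier G|"
      using card_leq_Un[OF 2 _ card_of_image[of \<theta> "carrier G"], of "{h}"] by (simp add: S_def)
    then have "|K| \<le>o |carrier G|"
      using card_of_UNION_ordLeq_infinite[OF 2, of "UNIV :: nat set" "W_gen H S"]
        W_gen_card[OF 2, of S H] infinite_iff_card_of_nat[of "carrier G"] 2
      by (simp add: K_def)
    then obtain e where e: "inj_on e K" "e ` K \<subseteq> carrier G"
      unfolding card_of_ordLeq[symmetric] by blast
    have SH: "S \<subseteq> carrier H" using sub h by (auto simp: S_def)
    have genH: "W_gen H S n \<subseteq> carrier H" for n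
    proof (induction n)
      case 0
      show ?case using SH by simp
    next
      case (Suc n)
      then show ?case
        by (auto simp: Let_def subset_iff hcl)
    qed
    have "W_gen H S n \<subseteq> W_gen H S (Suc n)" for n
      by (auto simp: Let_def)
    then have mono: "W_gen H S m \<subseteq> W_gen H S n" if "m \<le> n" for m n
      using that by (rule lift_Suc_mono_le)
    have step: "inv\<^bsub>add_grp H\<^esub> x \<in> K" "wadd H x y \<in> K" "x \<squnion>\<^bsub>H\<^esub> y \<in> K" "x \<sqinter>\<^bsub>H\<^esub> y \<in> K"
      if xy: "x \<in> K" "y \<in> K" for x y
    proof -
      obtain m n where "x \<in> W_gen H S m" "y \<in> W_gen H S n" using xy by (auto simp: K_def)
      then have "x \<in> W_gen H S (max m n)" "y \<in> W_gen H S (max m n)"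
        using mono[of m "max m n"] mono[of n "max m n"] by auto
      then have "inv\<^bsub>add_grp H\<^esub> x \<in> W_gen H S (Suc (max m n))"
        "wadd H x y \<in> W_gen H S (Suc (max m n))"
        "x \<squnion>\<^bsub>H\<^esub> y \<in> W_gen H S (Suc (max m n))" "x \<sqinter>\<^bsub>H\<^esub> y \<in> W_gen H S (Suc (max m n))"
        by (force simp: Let_def)+
      then show "inv\<^bsub>add_grp H\<^esub> x \<in> K" "wadd H x y \<in> K" "x \<squnion>\<^bsub>H\<^esub> y \<in> K" "x \<sqinter>\<^bsub>H\<^esub> y \<in> K"
        unfolding K_def by blast+
    qed
    have SK: "S \<subseteq> K" using W_gen.simps(1)[of H S] unfolding K_def by blast
    have KH: "K \<subseteq> carrier H" using genH unfolding K_def by blast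
    have "wzero H \<in> K" "wunit H \<in> K" using SK z u by (auto simp: S_def)
    then have "W_closed H K"
      using KH step by (simp add: W_closed_def)
    with \<open>S \<subseteq> K\<close> e show thesis
      by (intro that[of K e]) (auto simp: S_def)
  qed
qed

end

theorem pointwise_join_is_lub:
  fixes G :: "'a wstruct" and H :: "'b wstruct"
  assumes G: "W_object G" and pj: "pointwise_join G f F"
    and H: "W_object H" and \<theta>: "\<theta> \<in> W_hom G H"
  shows "is_lub H (\<theta> f) (\<theta> ` F)"
proof -
  have f: "f \<in> carrier G" and F: "F \<subseteq> carrier G"
    using pj by (auto simp: pointwise_join_def)
  have "is_lub G (restrict id (carrier G) f) (restrict id (carrier G) ` F)"
    using pj G W_hom_id[OF G] unfolding pointwise_join_def by blast
  moreover have "restrict id (carrier G) ` F = F"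
    using F by force
  ultimately have "is_lub G f F" using f by simp
  then have ub: "x \<sqsubseteq>\<^bsub>G\<^esub> f" if "x \<in> F" for x
    using that F by (auto simp: least_def Upper_def)
  have "\<theta> f \<sqsubseteq>\<^bsub>H\<^esub> h" if h: "h \<in> Upper H (\<theta> ` F)" for h
  proof -
    have hH: "h \<in> carrier H" using h by (simp add: Upper_def)
    obtain K and e :: "'b \<Rightarrow> 'a" where
      K: "W_closed H K" "\<theta> ` carrier G \<subseteq> K" "h \<in> K" "inj_on e K"
      by (rule small_subobject[OF G H \<theta> hH])
    let ?C = "W_copy H K e" and ?t = "compose (carrier G) e \<theta>"
    have "is_lub ?C (?t f) (?t ` F)"
      using pj W_object_copy[OF H K(1,4)] W_hom_copy[OF H K(1,4) G \<theta> K(2)]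
      by (auto simp: pointwise_join_def)
    moreover have "e h \<in> Upper ?C (?t ` F)"
    proof -
      have "e (\<theta> x) \<sqsubseteq>\<^bsub>?C\<^esub> e h" if "x \<in> F" for x
      proof -
        have "\<theta> x \<in> K" using that F K(2) by blast
        moreover have "\<theta> x \<sqsubseteq>\<^bsub>H\<^esub> h"
          using h that F W_hom_closed[OF \<theta>] by (auto simp: Upper_def)
        ultimately show ?thesis using copy_le[OF H K(1,4)] K(3) by blast
      qed
      then show ?thesis
        using F K(3) by (auto simp: Upper_def copy_carrier[OF H K(1,4)] compose_def)
    qed
    ultimately have "?t f \<sqsubseteq>\<^bsub>?C\<^esub> e h" by (auto simp: least_def)
    moreover have "\<theta> f \<in> K" using f K(2) by blast
    ultimately show ?thesis
      using f K(3) copy_le[OF H K(1,4)] by (simp add: compose_def)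
  qed
  moreover have "\<theta> f \<in> Upper H (\<theta> ` F)"
    using W_hom_closed[OF \<theta>] f F ub W_hom_mono[OF G H \<theta>] by (auto simp: Upper_def)
  ultimately show ?thesis by (auto simp: least_def Upper_def)
qed

theorem cut_if_is_lub_extension:
  fixes G :: "'a wstruct" and H :: "'b wstruct"
  assumes G: "W_object G" and Z: "downset G Z"
    and ext: "W_extension G H \<theta>" and s: "is_lub H s (\<theta> ` Z)"
  shows "cut G Z"
proof -
  have H: "W_object H" and \<theta>: "\<theta> \<in> W_hom G H" and inj: "inj_on \<theta> (carrier G)"
    using ext by (auto simp: W_extension_def)
  have ZG: "Z \<subseteq> carrier G" using Z by (simp add: downset_def)
  have sH: "s \<in> carrier H" using s by (auto simp: least_def Upper_def)
  obtain K and e :: "'b \<Rightarrow> 'a" where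
    K: "W_closed H K" "\<theta> ` carrier G \<subseteq> K" "s \<in> K" "inj_on e K"
    by (rule small_subobject[OF G H \<theta> sH])
  let ?C = "W_copy H K e" and ?t = "compose (carrier G) e \<theta>"
  have "W_extension G ?C ?t"
    using W_object_copy[OF H K(1,4)] W_hom_copy[OF H K(1,4) G \<theta> K(2)] inj
      inj_on_subset[OF K(4,2)]
    by (auto simp: W_extension_def compose_def inj_on_def)
  moreover have "is_lub ?C (e s) (e ` \<theta> ` Z)"
    using ZG K by (intro copy_is_lubI[OF H K(1,4) _ K(3) s]) blast
  moreover have "e ` \<theta> ` Z = ?t ` Z"
    using ZG by (force simp: compose_def)
  ultimately show ?thesis using Z unfolding cut_def by metis
qed

end

theory Submission
  imports Defs Complex_Main "HOL-Library.Nat_Bijection"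
begin

text \<open>The reflection of \<open>G\<close> consists of the Baire functions on the space of all maps
  \<open>x: carrier G \<rightarrow> \<real>\<close> modulo almost everywhere equality, where a property holds almost everywhere if
  it holds for all \<open>x\<close> which respect the operations of \<open>G\<close> on some countable set of elements; \<open>a\<close> is
  sent to the evaluation at \<open>a\<close>. Everywhere finite countable suprema of Baire functions are
  pointwise joins in this quotient: they converge in a way that is governed by regulators which are
  again Baire functions, and hence is preserved by every morphism into an archimedean object.

  Evaluation is injective, because a Rasiowa--Sikorski argument gives, for countably many elements
  and a given \<open>p > 0\<close>, a real valued \<open>x\<close> that respects the operations on them and has \<open>x p > 0\<close>.
  So for a pointwise \<open>\<sigma>\<close>-complete \<open>H\<close> the quotient is an extension of \<open>H\<close> in which suprema of
  countable subsets of \<open>H\<close> witness cuts of \<open>H\<close>; the pointwise joins of these cuts show that \<open>H\<close> is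
  the whole quotient. Substitution into Baire functions then extends morphisms \<open>G \<rightarrow> H\<close> to the
  reflection, uniquely since every Baire function is reached from evaluations by operations and
  joins that morphisms preserve.\<close>

section \<open>Lattice-ordered groups\<close>

text \<open>The rewrites phrase the inherited group laws through \<open>wadd G\<close> and
  \<open>wzero G\<close>, so that they match terms about \<open>G\<close> directly.\<close>

sublocale W_object \<subseteq> add: comm_group "add_grp G"
  rewrites "carrier (add_grp G) = carrier G" and "monoid.mult (add_grp G) = wadd G"
    and "one (add_grp G) = wzero G"
  by (simp_all add: add_group)

context W_object
begin

abbreviation plus (infixl "\<oplus>" 65) where "x \<oplus> y \<equiv> wadd G x y"
abbreviation neg ("\<ominus> _" [81] 80) where "\<ominus> x \<equiv> inv\<^bsub>add_grp G\<^esub> x"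
abbreviation zero ("\<zero>") where "\<zero> \<equiv> wzero G"
abbreviation nmul :: "nat \<Rightarrow> 'a \<Rightarrow> 'a" (infixr "\<cdot>" 75) where "n \<cdot> x \<equiv> x [^]\<^bsub>add_grp G\<^esub> n"
abbreviation zmul :: "int \<Rightarrow> 'a \<Rightarrow> 'a" (infixr "\<odot>" 75) where "n \<odot> x \<equiv> x [^]\<^bsub>add_grp G\<^esub> n"

lemma add_mono2:
  assumes "x \<sqsubseteq> y" "z \<sqsubseteq> w" "x \<in> carrier G" "y \<in> carrier G" "z \<in> carrier G" "w \<in> carrier G"
  shows "x \<oplus> z \<sqsubseteq> y \<oplus> w"
proof -
  have "x \<oplus> z \<sqsubseteq> y \<oplus> z" using assms by (intro add_mono)
  moreover have "y \<oplus> z \<sqsubseteq> y \<oplus> w"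
    using add_mono[of z w y] assms by (simp add: add.m_comm[of y])
  ultimately show ?thesis using assms by (meson add.m_closed le_trans)
qed

lemma diff_le_iff:
  assumes "x \<in> carrier G" "y \<in> carrier G" "z \<in> carrier G"
  shows "x \<oplus> \<ominus> z \<sqsubseteq> y \<longleftrightarrow> x \<sqsubseteq> y \<oplus> z"
  using add_mono[of "x \<oplus> \<ominus> z" y z] add_mono[of x "y \<oplus> z" "\<ominus> z"] assms
  by (auto simp: add.m_assoc)

lemma le_diff_iff:
  assumes "x \<in> carrier G" "y \<in> carrier G" "z \<in> carrier G"
  shows "x \<sqsubseteq> y \<oplus> \<ominus> z \<longleftrightarrow> x \<oplus> z \<sqsubseteq> y"
  using add_mono[of "x \<oplus> z" y "\<ominus> z"] add_mono[of x "y \<oplus> \<ominus> z" z] assms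
  by (auto simp: add.m_assoc)

lemma nmul_mono:
  assumes "x \<sqsubseteq> y" "x \<in> carrier G" "y \<in> carrier G"
  shows "n \<cdot> x \<sqsubseteq> n \<cdot> y"
  by (induction n) (use assms in \<open>auto intro: add_mono2\<close>)

lemma nmul_nonneg: "\<zero> \<sqsubseteq> x \<Longrightarrow> x \<in> carrier G \<Longrightarrow> \<zero> \<sqsubseteq> n \<cdot> x"
  using nmul_mono[of \<zero> x n] by simp

lemma le_add_nonneg: "\<zero> \<sqsubseteq> y \<Longrightarrow> x \<in> carrier G \<Longrightarrow> y \<in> carrier G \<Longrightarrow> x \<sqsubseteq> x \<oplus> y"
  using add_mono2[of x x \<zero> y] by simp

lemma diff_nonneg_le: "\<zero> \<sqsubseteq> y \<Longrightarrow> x \<in> carrier G \<Longrightarrow> y \<in> carrier G \<Longrightarrow> x \<oplus> \<ominus> y \<sqsubseteq> x"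
  by (simp add: diff_le_iff le_add_nonneg)

text \<open>For \<open>w = p \<sqinter> (u + v)\<close>, the element \<open>w - v\<close> lies below
  both \<open>p\<close> and \<open>u\<close>, hence is nonpositive; so \<open>w \<le> v\<close>, and
  then \<open>w\<close> lies below \<open>p \<sqinter> v\<close>.\<close>

lemma disjoint_add:
  assumes "p \<sqinter> u \<sqsubseteq> \<zero>" "p \<sqinter> v \<sqsubseteq> \<zero>" "\<zero> \<sqsubseteq> u" "\<zero> \<sqsubseteq> v"
    and "p \<in> carrier G" "u \<in> carrier G" "v \<in> carrier G"
  shows "p \<sqinter> (u \<oplus> v) \<sqsubseteq> \<zero>"
proof -
  define w where "w = p \<sqinter> (u \<oplus> v)"
  have w: "w \<in> carrier G" "w \<sqsubseteq> p" "w \<sqsubseteq> u \<oplus> v"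
    using assms by (simp_all add: w_def meet_left meet_right)
  have "w \<oplus> \<ominus> v \<sqsubseteq> w" using assms w by (simp add: diff_nonneg_le)
  then have "w \<oplus> \<ominus> v \<sqsubseteq> p" using w assms by (meson add.inv_closed add.m_closed le_trans)
  moreover have "w \<oplus> \<ominus> v \<sqsubseteq> u" using w assms by (simp add: diff_le_iff)
  ultimately have "w \<oplus> \<ominus> v \<sqsubseteq> p \<sqinter> u" using w assms by (intro meet_le) auto
  then have "w \<oplus> \<ominus> v \<sqsubseteq> \<zero>"
    using assms w by (meson add.inv_closed add.m_closed add.one_closed le_trans meet_closed)
  then have "w \<sqsubseteq> v" using w assms by (simp add: diff_le_iff)
  then have "w \<sqsubseteq> p \<sqinter> v" using w assms by (intro meet_le) auto
  then show ?thesis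
    using assms w by (fold w_def) (meson add.one_closed le_trans meet_closed)
qed

section \<open>Positive elements as conditions that decide signs\<close>

definition pos where "pos p \<longleftrightarrow> p \<in> carrier G \<and> \<zero> \<sqsubseteq> p \<and> p \<noteq> \<zero>"

text \<open>\<open>forces p y\<close> says that \<open>y \<le> 0\<close> wherever \<open>p > 0\<close>.\<close>

definition forces where "forces p y \<longleftrightarrow> p \<sqinter> (y \<squnion> \<zero>) \<sqsubseteq> \<zero>"

lemma forces_mono:
  assumes "forces p y" "q \<sqsubseteq> p" "z \<sqsubseteq> y"
    "p \<in> carrier G" "q \<in> carrier G" "y \<in> carrier G" "z \<in> carrier G"
  shows "forces q z"
proof -
  have "z \<squnion> \<zero> \<sqsubseteq> y \<squnion> \<zero>"
    using assms by (intro join_le) (auto intro: le_trans[OF _ join_left] join_right)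
  then have "q \<sqinter> (z \<squnion> \<zero>) \<sqsubseteq> p \<sqinter> (y \<squnion> \<zero>)"
    using assms by (intro meet_le)
      (auto intro: le_trans[OF meet_left] le_trans[OF meet_right])
  then show ?thesis
    using assms unfolding forces_def by (meson add.one_closed join_closed le_trans meet_closed)
qed

text \<open>This is \<open>disjoint_add\<close> for positive parts, because
  \<open>(y + z)^+ \<le> y^+ + z^+\<close>.\<close>

lemma forces_add:
  assumes "forces p y" "forces p z" "p \<in> carrier G" "y \<in> carrier G" "z \<in> carrier G"
  shows "forces p (y \<oplus> z)"
proof -
  have "p \<sqinter> ((y \<squnion> \<zero>) \<oplus> (z \<squnion> \<zero>)) \<sqsubseteq> \<zero>"
    using assms by (intro disjoint_add) (auto simp: forces_def join_right)
  moreover have "(y \<oplus> z) \<squnion> \<zero> \<sqsubseteq> (y \<squnion> \<zero>) \<oplus> (z \<squnion> \<zero>)"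
    using assms add_mono2[of \<zero> "y \<squnion> \<zero>" \<zero> "z \<squnion> \<zero>"]
    by (intro join_le add_mono2) (auto simp: join_left join_right)
  then have "p \<sqinter> ((y \<oplus> z) \<squnion> \<zero>) \<sqsubseteq> p \<sqinter> ((y \<squnion> \<zero>) \<oplus> (z \<squnion> \<zero>))"
    using assms by (intro meet_le) (auto intro: le_trans[OF meet_left] le_trans[OF meet_right] meet_left)
  ultimately show ?thesis
    using assms unfolding forces_def
    by (meson add.m_closed add.one_closed join_closed le_trans meet_closed)
qed

lemma forces_nonpos:
  assumes "y \<sqsubseteq> \<zero>" "p \<in> carrier G" "y \<in> carrier G"
  shows "forces p y"
proof -
  have "y \<squnion> \<zero> \<sqsubseteq> \<zero>" using assms by (intro join_le) auto
  then show ?thesis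
    using assms unfolding forces_def by (meson add.one_closed join_closed le_trans meet_closed meet_right)
qed

lemma forces_pos_part:
  assumes "forces p y" "p \<in> carrier G" "y \<in> carrier G"
  shows "forces p (y \<squnion> \<zero>)"
proof -
  have "(y \<squnion> \<zero>) \<squnion> \<zero> \<sqsubseteq> y \<squnion> \<zero>" using assms by (intro join_le) (auto simp: join_left join_right)
  then have "p \<sqinter> ((y \<squnion> \<zero>) \<squnion> \<zero>) \<sqsubseteq> p \<sqinter> (y \<squnion> \<zero>)"
    using assms by (intro meet_le) (auto intro: le_trans[OF meet_left] le_trans[OF meet_right] meet_left)
  then show ?thesis using assms unfolding forces_def
    by (meson add.one_closed join_closed le_trans meet_closed)
qed

lemma pos_meet_unit:
  assumes "pos p" shows "pos (p \<sqinter> wunit G)"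
  using assms weak_unit[of p] unit_closed unit_nonneg
  by (auto simp: pos_def intro: meet_le)

text \<open>Otherwise \<open>p\<close> would be disjoint from the weak unit. This keeps the cone of
  forced elements proper.\<close>

lemma not_forces_unit:
  assumes "pos p" shows "\<not> forces p (wunit G)"
proof
  assume f: "forces p (wunit G)"
  have "wunit G \<squnion> \<zero> = wunit G"
    using unit_closed unit_nonneg by (intro le_antisym join_le) (auto simp: join_left)
  then have "p \<sqinter> wunit G \<sqsubseteq> \<zero>" using f by (simp add: forces_def)
  then show False using pos_meet_unit[OF assms] le_antisym[of "p \<sqinter> wunit G" \<zero>]
    by (auto simp: pos_def)
qed

text \<open>With \<open>s = y^+\<close> one has \<open>(-y)^+ \<le> s - y\<close>. A common lower
  bound \<open>w\<close> of the two parts therefore satisfies \<open>y \<le> s - w\<close> and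
  \<open>0 \<le> s - w\<close>, so \<open>s \<le> s - w\<close> and
  \<open>w \<le> 0\<close>.\<close>

lemma disjoint_pos_neg:
  assumes y: "y \<in> carrier G"
  shows "(y \<squnion> \<zero>) \<sqinter> (\<ominus> y \<squnion> \<zero>) \<sqsubseteq> \<zero>"
proof -
  define s w where "s = y \<squnion> \<zero>" and "w = (y \<squnion> \<zero>) \<sqinter> (\<ominus> y \<squnion> \<zero>)"
  have c: "s \<in> carrier G" "w \<in> carrier G" and s: "y \<sqsubseteq> s" "\<zero> \<sqsubseteq> s" and w: "w \<sqsubseteq> s" "w \<sqsubseteq> \<ominus> y \<squnion> \<zero>"
    using y by (simp_all add: s_def w_def join_left join_right meet_left meet_right)
  have "\<ominus> y \<squnion> \<zero> \<sqsubseteq> s \<oplus> \<ominus> y"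
    using y c s add_mono2[of \<zero> s "\<ominus> y" "\<ominus> y"] by (intro join_le) (auto simp: le_diff_iff)
  then have "w \<sqsubseteq> s \<oplus> \<ominus> y"
    using w y c by (meson add.inv_closed add.m_closed add.one_closed le_trans join_closed)
  then have "w \<oplus> y \<sqsubseteq> s" using c y by (simp add: le_diff_iff)
  then have "y \<sqsubseteq> s \<oplus> \<ominus> w" using c y by (simp add: le_diff_iff add.m_comm)
  moreover have "\<zero> \<sqsubseteq> s \<oplus> \<ominus> w" using c w by (simp add: le_diff_iff)
  ultimately have "s \<sqsubseteq> s \<oplus> \<ominus> w" unfolding s_def using c y by (intro join_le) (auto simp: s_def)
  then have "s \<oplus> w \<sqsubseteq> s" using c by (simp add: le_diff_iff)
  then have "w \<oplus> s \<sqsubseteq> s" using c by (simp add: add.m_comm)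
  then have "w \<sqsubseteq> s \<oplus> \<ominus> s" using c by (simp only: le_diff_iff)
  then show ?thesis using c by (fold w_def) simp
qed

text \<open>Density of deciding the sign of \<open>y\<close>: if \<open>p\<close> does not force
  \<open>y\<close>, then \<open>p \<sqinter> y^+\<close> is positive, and it forces
  \<open>-y\<close> since \<open>y^+\<close> and \<open>(-y)^+\<close> are disjoint.\<close>

lemma pos_decides:
  assumes p: "pos p" and y: "y \<in> carrier G"
  obtains q where "pos q" "q \<sqsubseteq> p" "forces q y \<or> forces q (\<ominus> y)"
proof (cases "p \<sqinter> (y \<squnion> \<zero>) \<sqsubseteq> \<zero>")
  case True
  then show ?thesis using that[of p] p by (auto simp: pos_def forces_def)
next
  case False
  let ?q = "p \<sqinter> (y \<squnion> \<zero>)"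
  have pc: "p \<in> carrier G" "\<zero> \<sqsubseteq> p" using p by (auto simp: pos_def)
  have "\<zero> \<sqsubseteq> ?q" using pc y by (intro meet_le) (auto simp: join_right)
  then have "pos ?q" using False pc y by (auto simp: pos_def)
  moreover have "forces ?q (\<ominus> y)"
    using disjoint_pos_neg[OF y] forces_mono[of "y \<squnion> \<zero>" "\<ominus> y" ?q "\<ominus> y"] pc y
    by (auto simp: forces_def meet_right)
  ultimately show ?thesis using that[of ?q] pc y by (auto simp: meet_left)
qed

text \<open>Density of bounding \<open>d\<close> by a multiple of the unit, which will make its
  value finite. If \<open>p' = p \<sqinter> 1\<close> were disjoint from every
  \<open>(n 1 - d)^+\<close>, then \<open>n p' \<le> n 1\<close> would give
  \<open>n p' \<le> d^+\<close> for all \<open>n\<close>, against archimedeanity. For an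
  \<open>n\<close> where this fails, \<open>p' \<sqinter> (n 1 - d)^+\<close> is the required
  condition.\<close>

lemma force_bound:
  assumes p: "pos p" and d: "d \<in> carrier G"
  obtains q n where "pos q" "q \<sqsubseteq> p" "forces q (d \<oplus> \<ominus> (n \<cdot> wunit G))"
proof -
  have pc: "p \<in> carrier G" "\<zero> \<sqsubseteq> p" using p by (auto simp: pos_def)
  define p' where "p' = p \<sqinter> wunit G"
  have p': "pos p'" "p' \<in> carrier G" "p' \<sqsubseteq> p" "p' \<sqsubseteq> wunit G" "\<zero> \<sqsubseteq> p'"
    using pos_meet_unit[OF p] pc unit_closed by (auto simp: p'_def meet_left meet_right pos_def)
  define y where "y n = (n \<cdot> wunit G) \<oplus> \<ominus> d" for n :: nat
  have y: "y n \<in> carrier G" for n using d unit_closed by (simp add: y_def)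
  have "\<exists>n. \<not> forces p' (y n)"
  proof (rule ccontr)
    assume "\<not> ?thesis"
    then have all: "p' \<sqinter> (y n \<squnion> \<zero>) \<sqsubseteq> \<zero>" for n by (auto simp: forces_def)
    have "n \<cdot> p' \<sqsubseteq> d \<squnion> \<zero>" for n
    proof -
      let ?w = "n \<cdot> p'"
      have dis: "(y n \<squnion> \<zero>) \<sqinter> (m \<cdot> p') \<sqsubseteq> \<zero>" for m :: nat
      proof (induction m)
        case 0
        then show ?case using y by (simp add: meet_right)
      next
        case (Suc m)
        then show ?case using all[of n] p' y
          by (auto intro!: disjoint_add nmul_nonneg simp: meet_comm)
      qed
      \<comment> \<open>The element \<open>?w - d^+\<close> lies below both \<open>(y n)^+\<close>
        and \<open>?w\<close>, which are disjoint by \<open>dis\<close>; so it is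
        nonpositive.\<close>
      have w: "?w \<in> carrier G" "?w \<oplus> \<ominus> (d \<squnion> \<zero>) \<sqsubseteq> ?w"
        using p' d by (auto intro!: diff_nonneg_le simp: join_right)
      have "?w \<sqsubseteq> n \<cdot> wunit G" using p' unit_closed by (intro nmul_mono)
      then have "?w \<sqsubseteq> y n \<oplus> (d \<squnion> \<zero>)"
        using w(1) d unit_closed add_mono2[of "?w \<oplus> \<ominus> d" "y n" d "d \<squnion> \<zero>"]
          add_mono[of ?w "n \<cdot> wunit G" "\<ominus> d"] y[of n]
        by (auto simp: y_def add.m_assoc join_left)
      then have "?w \<oplus> \<ominus> (d \<squnion> \<zero>) \<sqsubseteq> y n"
        using w d y by (simp add: diff_le_iff)
      then have "?w \<oplus> \<ominus> (d \<squnion> \<zero>) \<sqsubseteq> y n \<squnion> \<zero>"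
        using w d y by (meson add.inv_closed add.m_closed add.one_closed join_closed join_left le_trans)
      then have "?w \<oplus> \<ominus> (d \<squnion> \<zero>) \<sqsubseteq> (y n \<squnion> \<zero>) \<sqinter> ?w"
        using w d y by (intro meet_le) auto
      then have "?w \<oplus> \<ominus> (d \<squnion> \<zero>) \<sqsubseteq> \<zero>"
        using dis[of n] w d y
        by (meson add.inv_closed add.m_closed add.one_closed join_closed le_trans meet_closed)
      then show ?thesis using w d by (simp add: diff_le_iff)
    qed
    then have "p' = \<zero>" using p' d by (intro archimedean[of p' "d \<squnion> \<zero>"]) auto
    then show False using p' by (simp add: pos_def)
  qed
  then obtain n where n: "\<not> forces p' (y n)" by blast
  let ?q = "p' \<sqinter> (y n \<squnion> \<zero>)"
  have q: "?q \<in> carrier G" "?q \<sqsubseteq> y n \<squnion> \<zero>" "?q \<sqsubseteq> p'" "\<zero> \<sqsubseteq> ?q"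
    using p' y by (auto intro: meet_le simp: meet_left meet_right join_right)
  have "\<ominus> y n = d \<oplus> \<ominus> (n \<cdot> wunit G)"
    using d unit_closed by (simp add: y_def add.inv_mult add.m_comm)
  then have "forces ?q (d \<oplus> \<ominus> (n \<cdot> wunit G))"
    using disjoint_pos_neg[OF y[of n]] forces_mono[of "y n \<squnion> \<zero>" "\<ominus> y n" ?q "\<ominus> y n"] q y[of n] add.inv_closed[OF y[of n]]
    by (auto simp: forces_def)
  moreover have "pos ?q" using n q by (auto simp: forces_def pos_def)
  moreover have "?q \<sqsubseteq> p" using q p' pc by (meson le_trans)
  ultimately show ?thesis using that by blast
qed

end

section \<open>Real points\<close>

text \<open>The equations are required only for arguments in \<open>C\<close>, because an
  archimedean object need not have any real valued point that respects the operations on all of it;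
  for countable \<open>C\<close> such points exist in abundance.\<close>

definition partial_hom :: "'a wstruct \<Rightarrow> 'a set \<Rightarrow> ('a \<Rightarrow> real) \<Rightarrow> bool" where
  "partial_hom G C x \<longleftrightarrow> x (wunit G) = 1 \<and>
     (\<forall>a\<in>C. \<forall>b\<in>C. x (wadd G a b) = x a + x b \<and>
        x (a \<squnion>\<^bsub>G\<^esub> b) = max (x a) (x b) \<and> x (a \<sqinter>\<^bsub>G\<^esub> b) = min (x a) (x b))"

text \<open>\<open>N\<close> stands for the elements whose value at a point is at most 0.
  Accordingly \<open>i 1 - k d \<in> N\<close> with \<open>k > 0\<close> says that the value of
  \<open>d\<close> is at least \<open>i / k\<close>.\<close>

locale W_cone = W_object G for G :: "'a wstruct" (structure) +
  fixes N :: "'a set"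
  assumes N_carrier: "N \<subseteq> carrier G"
    and N_add: "y \<in> N \<Longrightarrow> z \<in> N \<Longrightarrow> wadd G y z \<in> N"
    and N_down: "y \<in> N \<Longrightarrow> z \<in> carrier G \<Longrightarrow> z \<sqsubseteq> y \<Longrightarrow> z \<in> N"
    and N_zero: "wzero G \<in> N"
    and N_pos_part: "y \<in> N \<Longrightarrow> y \<squnion> wzero G \<in> N"
    and N_unit: "wunit G \<notin> N"
begin

section \<open>Real values prescribed by a cone\<close>

definition affine :: "int \<Rightarrow> int \<Rightarrow> 'a \<Rightarrow> 'a" where "affine k i d = k \<odot> d \<oplus> i \<odot> wunit G"

lemma affine_closed [simp]: "d \<in> carrier G \<Longrightarrow> affine k i d \<in> carrier G"
  using unit_closed by (simp add: affine_def)

lemma affine_add: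
  assumes "d \<in> carrier G" "e \<in> carrier G"
  shows "affine k i d \<oplus> affine k j e = affine k (i + j) (d \<oplus> e)"
  using assms unit_closed
  by (simp add: affine_def add.int_pow_distrib add.int_pow_mult add.m_ac)

lemma affine_mul:
  assumes "d \<in> carrier G"
  shows "n \<odot> affine k i d = affine (k * n) (i * n) d"
  using assms unit_closed
  by (simp add: affine_def add.int_pow_distrib add.int_pow_pow)

lemma affine_neg: "d \<in> carrier G \<Longrightarrow> affine k i (\<ominus> d) = affine (- k) i d"
  by (simp add: affine_def add.int_pow_neg add.int_pow_inv)

lemma neg_affine: "d \<in> carrier G \<Longrightarrow> \<ominus> affine k i d = affine (- k) (- i) d"
  using unit_closed by (simp add: affine_def add.int_pow_neg add.inv_mult)

lemma N_mul:
  assumes "y \<in> N" "0 \<le> n" shows "n \<odot> y \<in> N"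
proof -
  have "m \<cdot> y \<in> N" for m
    by (induction m) (use assms N_zero N_add in auto)
  from this[of "nat n"] show ?thesis using assms by (metis int_pow_int int_nat_eq)
qed

lemma N_unit_mul:
  assumes "z \<odot> wunit G \<in> N" shows "z \<le> 0"
proof (rule ccontr)
  assume "\<not> z \<le> 0"
  then obtain m where m: "z = int (Suc m)" by (metis not_le zero_less_imp_eq_int gr0_implies_Suc)
  have "z \<odot> wunit G = Suc m \<cdot> wunit G" unfolding m by (rule int_pow_int)
  then have "wunit G \<sqsubseteq> z \<odot> wunit G"
    using le_add_nonneg[of "m \<cdot> wunit G" "wunit G"] unit_closed unit_nonneg nmul_nonneg[of "wunit G" m]
    by (simp add: add.m_comm)
  then show False using N_down[OF assms unit_closed] N_unit by blast
qed

text \<open>The lower Dedekind cut of the real value which \<open>N\<close> prescribes for \<open>d\<close>.\<close>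

definition lower :: "'a \<Rightarrow> real set" where
  "lower d = {real_of_int i / real_of_int k | i k. k > 0 \<and> affine (- k) i d \<in> N}"

lemma lowerI: "k > 0 \<Longrightarrow> affine (- k) i d \<in> N \<Longrightarrow> real_of_int i / real_of_int k \<in> lower d"
  by (auto simp: lower_def)

lemma lower_add:
  assumes "u \<in> lower d" "v \<in> lower e" "d \<in> carrier G" "e \<in> carrier G"
  shows "u + v \<in> lower (d \<oplus> e)"
proof -
  obtain i k j l where ik: "k > 0" "affine (- k) i d \<in> N" "u = real_of_int i / real_of_int k"
    and jl: "l > 0" "affine (- l) j e \<in> N" "v = real_of_int j / real_of_int l"
    using assms(1,2) by (auto simp: lower_def)
  have "affine (- k * l) (i * l) d \<oplus> affine (- l * k) (j * k) e \<in> N"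
    using N_mul[OF ik(2), of l] N_mul[OF jl(2), of k] ik jl assms by (intro N_add) (simp_all add: affine_mul)
  then have "affine (- (k * l)) (i * l + j * k) (d \<oplus> e) \<in> N"
    using affine_add[of d e "- (k * l)" "i * l" "j * k"] assms by (simp add: mult.commute)
  then have "real_of_int (i * l + j * k) / real_of_int (k * l) \<in> lower (d \<oplus> e)"
    using ik jl by (intro lowerI) auto
  moreover have "u + v = real_of_int (i * l + j * k) / real_of_int (k * l)"
    using ik jl by (simp add: field_simps)
  ultimately show ?thesis by simp
qed

lemma lower_zero: "u \<in> lower \<zero> \<Longrightarrow> u \<le> 0"
  using N_unit_mul unit_closed by (auto simp: lower_def affine_def divide_nonpos_pos)

lemma lower_neg: "u \<in> lower d \<Longrightarrow> v \<in> lower (\<ominus> d) \<Longrightarrow> d \<in> carrier G \<Longrightarrow> u + v \<le> 0"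
  using lower_add[of u d v "\<ominus> d"] lower_zero[of "u + v"] by simp

text \<open>Adding \<open>k (d - e) \<in> N\<close> to \<open>i 1 - k d \<in> N\<close> gives
  \<open>i 1 - k e \<in> N\<close>.\<close>

lemma lower_mono:
  assumes "d \<oplus> \<ominus> e \<in> N" "d \<in> carrier G" "e \<in> carrier G"
  shows "lower d \<subseteq> lower e"
proof
  fix u assume "u \<in> lower d"
  then obtain i k where ik: "k > 0" "affine (- k) i d \<in> N" "u = real_of_int i / real_of_int k"
    by (auto simp: lower_def)
  have "k \<odot> (d \<oplus> \<ominus> e) = affine (- k) 0 (e \<oplus> \<ominus> d)"
    using assms affine_neg[of "e \<oplus> \<ominus> d" k 0] by (simp add: affine_def add.inv_mult add.m_comm)
  then have "affine (- k) 0 (e \<oplus> \<ominus> d) \<in> N"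
    using N_mul[OF assms(1), of k] ik by simp
  then have "affine (- k) (i + 0) (d \<oplus> (e \<oplus> \<ominus> d)) \<in> N"
    using N_add[OF ik(2), of "affine (- k) 0 (e \<oplus> \<ominus> d)"] affine_add[of d "e \<oplus> \<ominus> d" "- k" i 0] assms by simp
  moreover have "d \<oplus> (e \<oplus> \<ominus> d) = e" using assms by (simp add: add.m_lcomm[of d])
  ultimately show "u \<in> lower e" using ik by (auto simp: lower_def)
qed

text \<open>Two-sided boundedness by multiples of the unit modulo \<open>N\<close>; it makes the cut
  \<open>lower d\<close> nonempty and bounded above, so that its supremum is meaningful.\<close>

definition good where
  "good d \<longleftrightarrow> d \<in> carrier G \<and> (\<exists>n::nat. d \<oplus> \<ominus> (n \<cdot> wunit G) \<in> N) \<and>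
     (\<exists>n::nat. \<ominus> d \<oplus> \<ominus> (n \<cdot> wunit G) \<in> N)"

lemma good_neg: "good d \<Longrightarrow> good (\<ominus> d)"
  by (auto simp: good_def)

lemma good_lower:
  assumes "good d" shows "lower d \<noteq> {}" "bdd_above (lower d)"
proof -
  have d: "d \<in> carrier G" using assms by (simp add: good_def)
  have *: "- real n \<in> lower e" if "\<ominus> e \<oplus> \<ominus> (n \<cdot> wunit G) \<in> N" "e \<in> carrier G" for e and n :: nat
  proof -
    have "\<ominus> e \<oplus> \<ominus> (n \<cdot> wunit G) = affine (- 1) (- int n) e"
      using that unit_closed by (simp add: affine_def add.int_pow_neg int_pow_int)
    then show ?thesis using that lowerI[of 1 "- int n" e] by simp
  qed
  from assms obtain n where "\<ominus> d \<oplus> \<ominus> (n \<cdot> wunit G) \<in> N" by (auto simp: good_def)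
  from *[OF this d] show "lower d \<noteq> {}" by blast
  from assms obtain m where "d \<oplus> \<ominus> (m \<cdot> wunit G) \<in> N" by (auto simp: good_def)
  with *[of "\<ominus> d" m] d have "- real m \<in> lower (\<ominus> d)" by simp
  then have "u \<le> real m" if "u \<in> lower d" for u
    using lower_neg[OF that _ d] by fastforce
  then show "bdd_above (lower d)" by (auto simp: bdd_above_def)
qed

definition val :: "'a \<Rightarrow> real" where "val d = Sup (lower d)"

lemma le_val: "good d \<Longrightarrow> u \<in> lower d \<Longrightarrow> u \<le> val d"
  unfolding val_def by (intro cSup_upper good_lower)

lemma val_le: "good d \<Longrightarrow> (\<And>u. u \<in> lower d \<Longrightarrow> u \<le> s) \<Longrightarrow> val d \<le> s"
  unfolding val_def by (intro cSup_least good_lower)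

lemma val_superadd:
  assumes "good d" "good e" "good (d \<oplus> e)"
  shows "val d + val e \<le> val (d \<oplus> e)"
proof -
  have c: "d \<in> carrier G" "e \<in> carrier G" using assms by (auto simp: good_def)
  have "val d \<le> val (d \<oplus> e) - v" if v: "v \<in> lower e" for v
    using lower_add[OF _ v c] le_val[OF assms(3)] by (intro val_le assms) (simp add: le_diff_eq)
  then have "val e \<le> val (d \<oplus> e) - val d"
    by (intro val_le assms) fastforce
  then show ?thesis by simp
qed

text \<open>A rational \<open>r\<close> strictly between \<open>val d\<close> and
  \<open>- val (- d)\<close> would be decided by \<open>N\<close>: either \<open>r\<close> belongs
  to \<open>lower d\<close> or \<open>- r\<close> belongs to \<open>lower (- d)\<close>, and both
  contradict the choice of \<open>r\<close>.\<close>

lemma val_neg: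
  assumes d: "good d" and dec: "\<And>k i. affine k i d \<in> N \<or> \<ominus> affine k i d \<in> N"
  shows "val (\<ominus> d) = - val d"
proof (rule antisym)
  have c: "d \<in> carrier G" using d by (simp add: good_def)
  have "val d \<le> - v" if v: "v \<in> lower (\<ominus> d)" for v
    using lower_neg[OF _ v c] by (intro val_le d) fastforce
  then show "val (\<ominus> d) \<le> - val d" by (intro val_le good_neg d) fastforce
  show "- val d \<le> val (\<ominus> d)"
  proof (rule ccontr)
    assume "\<not> ?thesis"
    then obtain r where r: "r \<in> \<rat>" "val d < r" "r < - val (\<ominus> d)"
      using Rats_dense_in_real[of "val d" "- val (\<ominus> d)"] by auto
    then obtain i k where ik: "k > 0" "r = real_of_int i / real_of_int k"
      by (auto elim: Rats_cases')
    from dec[of "- k" i] show False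
    proof
      assume "affine (- k) i d \<in> N"
      with ik have "r \<in> lower d" by (auto simp: lower_def)
      with le_val[OF d] r show False by fastforce
    next
      assume "\<ominus> affine (- k) i d \<in> N"
      then have "affine (- k) (- i) (\<ominus> d) \<in> N" using c by (simp add: neg_affine affine_neg)
      with ik have "- r \<in> lower (\<ominus> d)" using lowerI[of k "- i"] by simp
      with le_val[OF good_neg[OF d]] r show False by fastforce
    qed
  qed
qed

lemma val_unit: "val (wunit G) = 1"
  unfolding val_def
proof (rule cSup_eq_maximum)
  show "1 \<in> lower (wunit G)"
    using lowerI[of 1 1 "wunit G"] N_zero unit_closed by (simp add: affine_def add.int_pow_neg)
  fix u assume "u \<in> lower (wunit G)"
  then obtain i k where ik: "k > 0" "affine (- k) i (wunit G) \<in> N" "u = real_of_int i / real_of_int k"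
    by (auto simp: lower_def)
  then have "(i - k) \<odot> wunit G \<in> N"
    using unit_closed add.int_pow_mult[of "wunit G" "- k" i] by (simp add: affine_def)
  then show "u \<le> 1" using N_unit_mul ik by (fastforce simp: field_simps)
qed

lemma val_cong:
  assumes "d \<oplus> \<ominus> e \<in> N" "e \<oplus> \<ominus> d \<in> N" "d \<in> carrier G" "e \<in> carrier G"
  shows "val d = val e"
  using lower_mono[of d e] lower_mono[of e d] assms by (simp add: val_def)

text \<open>The element \<open>s = (d - e)^+\<close> is in \<open>N\<close>, and
  \<open>d \<squnion> e \<le> e + s\<close> while \<open>d - s \<le> d \<sqinter> e\<close>. So
  modulo \<open>N\<close> the join agrees with \<open>e\<close> and the meet with
  \<open>d\<close>.\<close>

lemma val_join_meet:
  assumes d: "good d" and e: "good e" and N: "d \<oplus> \<ominus> e \<in> N"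
  shows "val (d \<squnion> e) = max (val d) (val e) \<and> val (d \<sqinter> e) = min (val d) (val e)"
proof -
  have c: "d \<in> carrier G" "e \<in> carrier G" using d e by (auto simp: good_def)
  have le: "val d \<le> val e"
    using lower_mono[OF N c] le_val[OF e] by (intro val_le d) auto
  define s where "s = (d \<oplus> \<ominus> e) \<squnion> \<zero>"
  have s: "s \<in> N" "s \<in> carrier G" "d \<oplus> \<ominus> e \<sqsubseteq> s" "\<zero> \<sqsubseteq> s"
    using N_pos_part[OF N] c by (auto simp: s_def join_left join_right)
  have dse: "d \<sqsubseteq> s \<oplus> e" using s c by (simp add: diff_le_iff)
  have "e \<sqsubseteq> s \<oplus> e" using le_add_nonneg[of s e] s c by (simp add: add.m_comm)
  then have "d \<squnion> e \<sqsubseteq> s \<oplus> e" using dse s c by (intro join_le) auto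
  then have "(d \<squnion> e) \<oplus> \<ominus> e \<in> N" using s c by (intro N_down[OF s(1)]) (auto simp: diff_le_iff)
  moreover have "e \<oplus> \<ominus> (d \<squnion> e) \<in> N"
    using c by (intro N_down[OF N_zero]) (auto simp: diff_le_iff join_right)
  ultimately have 1: "val (d \<squnion> e) = val e" using c by (intro val_cong) auto
  have "d \<oplus> \<ominus> s \<sqsubseteq> e" using dse s c by (simp add: diff_le_iff add.m_comm)
  moreover have "d \<oplus> \<ominus> s \<sqsubseteq> d" using s c by (intro diff_nonneg_le)
  ultimately have "d \<oplus> \<ominus> s \<sqsubseteq> d \<sqinter> e" using s c by (intro meet_le) auto
  then have "d \<sqsubseteq> s \<oplus> (d \<sqinter> e)" using s c by (simp add: diff_le_iff add.m_comm)
  then have "d \<oplus> \<ominus> (d \<sqinter> e) \<in> N" using s c by (intro N_down[OF s(1)]) (auto simp: diff_le_iff)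
  moreover have "(d \<sqinter> e) \<oplus> \<ominus> d \<in> N"
    using c by (intro N_down[OF N_zero]) (auto simp: diff_le_iff meet_left)
  ultimately have "val (d \<sqinter> e) = val d" using c by (intro val_cong) auto
  then show ?thesis using 1 le by simp
qed

lemma partial_hom_val:
  assumes good: "\<And>d. d \<in> C \<Longrightarrow> good d" "\<And>d e. d \<in> C \<Longrightarrow> e \<in> C \<Longrightarrow> good (d \<oplus> e)"
    and dec: "\<And>d k i. d \<in> C \<Longrightarrow> affine k i d \<in> N \<or> \<ominus> affine k i d \<in> N"
      "\<And>d e k i. d \<in> C \<Longrightarrow> e \<in> C \<Longrightarrow> affine k i (d \<oplus> e) \<in> N \<or> \<ominus> affine k i (d \<oplus> e) \<in> N"
    and cmp: "\<And>d e. d \<in> C \<Longrightarrow> e \<in> C \<Longrightarrow> d \<oplus> \<ominus> e \<in> N \<or> \<ominus> (d \<oplus> \<ominus> e) \<in> N"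
  shows "partial_hom G C val"
  unfolding partial_hom_def
proof (intro conjI ballI val_unit)
  fix d e assume C: "d \<in> C" "e \<in> C"
  then have c: "d \<in> carrier G" "e \<in> carrier G" using good by (auto simp: good_def)
  have sum: "\<ominus> d \<oplus> \<ominus> e = \<ominus> (d \<oplus> e)" using c by (simp add: add.inv_mult add.m_comm)
  have neg: "val (\<ominus> d) = - val d" "val (\<ominus> e) = - val e" "val (\<ominus> (d \<oplus> e)) = - val (d \<oplus> e)"
    by (rule val_neg[OF good(1)[OF C(1)] dec(1)[OF C(1)]] val_neg[OF good(1)[OF C(2)] dec(1)[OF C(2)]]
        val_neg[OF good(2)[OF C] dec(2)[OF C]])+
  \<comment> \<open>Superadditivity for \<open>d\<close> and \<open>e\<close> is one inequality; for
    their negatives it turns into the other one by \<open>neg\<close>.\<close>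
  show "val (d \<oplus> e) = val d + val e"
    using val_superadd[of d e] val_superadd[of "\<ominus> d" "\<ominus> e"] good C neg
    by (simp add: sum good_neg)
  have "\<ominus> (d \<oplus> \<ominus> e) = e \<oplus> \<ominus> d" using c by (simp add: add.inv_mult add.m_comm)
  then consider "d \<oplus> \<ominus> e \<in> N" | "e \<oplus> \<ominus> d \<in> N" using cmp[OF C] by auto
  then have "val (d \<squnion> e) = max (val d) (val e) \<and> val (d \<sqinter> e) = min (val d) (val e)"
  proof cases
    case 1 then show ?thesis using C by (intro val_join_meet good)
  next
    case 2
    from val_join_meet[OF good(1)[OF C(2)] good(1)[OF C(1)] this] show ?thesis
      by (simp add: join_comm[of G d e] meet_comm[of G d e] max.commute min.commute)
  qed
  then show "val (d \<squnion> e) = max (val d) (val e)" "val (d \<sqinter> e) = min (val d) (val e)" by auto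
qed

end

section \<open>Generic sequences and separating points\<close>

context W_object
begin

text \<open>The Rasiowa--Sikorski construction: the dense requirements are met one at a time along a
  descending sequence. Index 0 is reserved for the given \<open>p\<close>, so \<open>D i\<close> is
  met at index \<open>Suc i\<close>.\<close>

lemma generic_sequence:
  assumes "pos p" and dense: "\<And>i q. pos q \<Longrightarrow> \<exists>q'. pos q' \<and> q' \<sqsubseteq> q \<and> D (i :: nat) q'"
  shows "\<exists>P. P 0 = p \<and> (\<forall>i. pos (P i)) \<and> (\<forall>i j. i \<le> j \<longrightarrow> P j \<sqsubseteq> P i) \<and> (\<forall>i. D i (P (Suc i)))"
proof -
  have "\<exists>P. \<forall>i. (pos (P i) \<and> (i = 0 \<longrightarrow> P i = p)) \<and> (P (Suc i) \<sqsubseteq> P i \<and> D i (P (Suc i)))"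
    by (rule dependent_nat_choice) (use assms in \<open>auto\<close>)
  then obtain P where P_all: "\<forall>i. (pos (P i) \<and> (i = 0 \<longrightarrow> P i = p)) \<and> (P (Suc i) \<sqsubseteq> P i \<and> D i (P (Suc i)))"
    by (rule exE)
  have P: "P 0 = p" "pos (P i)" "P (Suc i) \<sqsubseteq> P i" "D i (P (Suc i))" for i
    using P_all by simp_all
  have "P j \<sqsubseteq> P i" if "i \<le> j" for i j
    using that
  proof (induction j rule: dec_induct)
    case base
    then show ?case using P(2)[of i] by (simp add: pos_def)
  next
    case (step j)
    then show ?case using P(2)[of i] P(2)[of j] P(2)[of "Suc j"] P(3)[of j]
      by (meson le_trans pos_def)
  qed
  then show ?thesis using P by (intro exI[of _ P] conjI allI impI) simp_all
qed

text \<open>The elements that some stage of a generic sequence forces to be nonpositive form a cone.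
  Genericity makes it decide and bound everything that \<open>partial_hom_val\<close> asks for, and
  the value function of the cone is the point.\<close>

lemma separating_point:
  assumes p: "pos p" and C: "countable C" "C \<subseteq> carrier G" "p \<in> C"
  obtains x where "partial_hom G C x" "0 < x p"
proof -
  have pc: "p \<in> carrier G" "\<zero> \<sqsubseteq> p" "p \<noteq> \<zero>" using p by (auto simp: pos_def)
  note u = unit_closed
  \<comment> \<open>Some multiple \<open>k p\<close> is not below the unit, so
    \<open>(k p - 1)^+\<close> is positive. Starting the generic sequence there forces
    \<open>1 \<le> k p\<close>, whence the value of \<open>p\<close> is at least
    \<open>1 / k\<close>.\<close>
  have "\<exists>k. \<not> k \<cdot> p \<sqsubseteq> wunit G"
    using archimedean[of p "wunit G"] pc u by auto
  then obtain k where k: "\<not> k \<cdot> p \<sqsubseteq> wunit G" by blast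
  define t where "t = (k \<cdot> p) \<oplus> \<ominus> wunit G"
  define p0 where "p0 = t \<squnion> \<zero>"
  have t: "t \<in> carrier G" "t \<sqsubseteq> p0" using pc u by (auto simp: t_def p0_def join_left)
  have "\<not> t \<sqsubseteq> \<zero>" using k pc u by (simp add: t_def diff_le_iff)
  then have p0: "pos p0" "p0 \<in> carrier G" using t by (auto simp: pos_def p0_def join_right)
  have p0_forces: "forces p0 (\<ominus> t)" using disjoint_pos_neg[OF t(1)] by (simp add: forces_def p0_def)

  \<comment> \<open>\<open>E\<close> includes the sums because additivity involves the value of
    \<open>d + e\<close>. The signs of the elements of \<open>Y\<close> have to be decided; those of
    \<open>B\<close> have to be bounded, and \<open>B\<close> is closed under negation to give
    bounds on both sides.\<close>
  define E where "E = C \<union> (\<lambda>(d, e). d \<oplus> e) ` (C \<times> C)"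
  define Y where "Y = (\<lambda>(k, i, d). k \<odot> d \<oplus> i \<odot> wunit G) ` (UNIV \<times> UNIV \<times> E) \<union> (\<lambda>(d, e). d \<oplus> \<ominus> e) ` (C \<times> C)"
  define B where "B = E \<union> (\<lambda>d. \<ominus> d) ` E"
  have E: "E \<subseteq> carrier G" "countable E" "E \<noteq> {}"
    using C by (auto simp: E_def)
  have Y: "Y \<subseteq> carrier G" "countable Y" "Y \<noteq> {}"
    using C E u by (auto simp: Y_def subset_iff)
  have B: "B \<subseteq> carrier G" "countable B" "B \<noteq> {}"
    using E by (auto simp: B_def)
  let ?y = "from_nat_into Y" and ?b = "from_nat_into B"
  have yc: "?y i \<in> carrier G" and bc: "?b i \<in> carrier G" for i
    using from_nat_into[OF Y(3)] from_nat_into[OF B(3)] Y B by auto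
  define D where "D i q \<longleftrightarrow> (forces q (?y i) \<or> forces q (\<ominus> ?y i)) \<and>
    (\<exists>n::nat. forces q (?b i \<oplus> \<ominus> (n \<cdot> wunit G)))" for i q
  have dense: "\<exists>q'. pos q' \<and> q' \<sqsubseteq> q \<and> D i q'" if q: "pos q" for i q
  proof -
    obtain r where r: "pos r" "r \<sqsubseteq> q" "forces r (?y i) \<or> forces r (\<ominus> ?y i)"
      by (rule pos_decides[OF q yc])
    obtain s n where s: "pos s" "s \<sqsubseteq> r" "forces s (?b i \<oplus> \<ominus> (n \<cdot> wunit G))"
      by (rule force_bound[OF r(1) bc])
    have c: "q \<in> carrier G" "r \<in> carrier G" "s \<in> carrier G" using q r s by (auto simp: pos_def)
    have "forces s (?y i) \<or> forces s (\<ominus> ?y i)"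
      using r s c yc[of i] by (auto intro: forces_mono)
    then have "D i s" using s by (auto simp: D_def)
    moreover have "s \<sqsubseteq> q" using c r s by (meson le_trans)
    ultimately show ?thesis using s by blast
  qed
  have "\<exists>P. P 0 = p0 \<and> (\<forall>i. pos (P i)) \<and> (\<forall>i j. i \<le> j \<longrightarrow> P j \<sqsubseteq> P i) \<and> (\<forall>i. D i (P (Suc i)))"
    by (rule generic_sequence[OF p0(1) dense])
  then obtain P where P_all: "P 0 = p0 \<and> (\<forall>i. pos (P i)) \<and> (\<forall>i j. i \<le> j \<longrightarrow> P j \<sqsubseteq> P i) \<and> (\<forall>i. D i (P (Suc i)))"
    by (rule exE)
  have P: "P 0 = p0" "pos (P i)" "i \<le> j \<Longrightarrow> P j \<sqsubseteq> P i" "D i (P (Suc i))" for i j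
    using P_all by simp_all
  have Pc: "P i \<in> carrier G" for i using P(2)[of i] by (simp add: pos_def)
  define N where "N = {y \<in> carrier G. \<exists>i. forces (P i) y}"
  have persist: "forces (P j) y" if "forces (P i) y" "i \<le> j" "y \<in> carrier G" for i j y
    using forces_mono[OF that(1) P(3)[OF that(2)] _ Pc Pc that(3) that(3)] that(3) by simp
  interpret N: W_cone G N
  proof unfold_locales
    fix y z assume "y \<in> N" "z \<in> N"
    then obtain i j where "forces (P i) y" "forces (P j) z" "y \<in> carrier G" "z \<in> carrier G"
      by (auto simp: N_def)
    then show "y \<oplus> z \<in> N"
      using persist[of i y "max i j"] persist[of j z "max i j"] Pc by (auto simp: N_def intro!: forces_add)
  next
    fix y z assume "y \<in> N" "z \<in> carrier G" "z \<sqsubseteq> y"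
    then obtain i where y: "y \<in> carrier G" "forces (P i) y" by (auto simp: N_def)
    have "forces (P i) z"
      using forces_mono[OF y(2) _ \<open>z \<sqsubseteq> y\<close> Pc Pc y(1) \<open>z \<in> carrier G\<close>] Pc[of i] by simp
    then show "z \<in> N" using \<open>z \<in> carrier G\<close> by (auto simp: N_def)
  next
    show "\<zero> \<in> N" using forces_nonpos[of \<zero> "P 0"] Pc by (auto simp: N_def)
  next
    show "wunit G \<notin> N" using not_forces_unit P(2) by (auto simp: N_def)
  qed (use Pc in \<open>auto simp: N_def intro: forces_pos_part\<close>)
  have Y_dec: "y \<in> N \<or> \<ominus> y \<in> N" if y: "y \<in> Y" for y
  proof -
    obtain i where "?y i = y" using from_nat_into_surj[OF Y(2) y] by (rule exE)
    then show ?thesis using P(4)[of i] y Y by (auto simp: D_def N_def)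
  qed
  have B_bound: "\<exists>n::nat. y \<oplus> \<ominus> (n \<cdot> wunit G) \<in> N" if y: "y \<in> B" for y
  proof -
    obtain i where "?b i = y" using from_nat_into_surj[OF B(2) y] by (rule exE)
    then show ?thesis using P(4)[of i] y B u by (auto simp: D_def N_def)
  qed
  have good: "N.good d" if "d \<in> E" for d
    using that B_bound[of d] B_bound[of "\<ominus> d"] E by (auto simp: N.good_def B_def)
  have dec: "N.affine k i d \<in> N \<or> \<ominus> N.affine k i d \<in> N" if "d \<in> E" for k i d
  proof -
    have "N.affine k i d \<in> Y"
      using that unfolding N.affine_def Y_def by (intro UnI1 image_eqI[of _ _ "(k, i, d)"]) auto
    then show ?thesis by (rule Y_dec)
  qed
  have "partial_hom G C N.val"
  proof (rule N.partial_hom_val)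
    fix d e assume "d \<in> C" "e \<in> C"
    then have Y: "d \<oplus> \<ominus> e \<in> Y" and E: "d \<oplus> e \<in> E"
      unfolding Y_def E_def by (intro UnI2 image_eqI[of _ _ "(d, e)"]; simp)+
    show "d \<oplus> \<ominus> e \<in> N \<or> \<ominus> (d \<oplus> \<ominus> e) \<in> N" "N.good (d \<oplus> e)"
      "N.affine k i (d \<oplus> e) \<in> N \<or> \<ominus> N.affine k i (d \<oplus> e) \<in> N" for k i
      by (rule Y_dec[OF Y] good[OF E] dec[OF E])+
  next
    fix d k i assume "d \<in> C"
    then have d: "d \<in> E" by (simp add: E_def)
    show "N.good d" "N.affine k i d \<in> N \<or> \<ominus> N.affine k i d \<in> N" by (rule good[OF d] dec[OF d])+
  qed
  moreover have "0 < N.val p"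
  proof -
    have "k \<noteq> 0" using k unit_nonneg by (intro notI) simp
    moreover have "\<ominus> t = N.affine (- int k) 1 p"
      using pc u by (simp add: t_def N.affine_def add.int_pow_neg int_pow_int add.inv_mult add.m_comm)
    then have "N.affine (- int k) 1 p \<in> N"
      using p0_forces t P(1) pc by (auto simp: N_def intro!: exI[of _ 0])
    ultimately have "1 / real k \<in> N.lower p"
      using N.lowerI[of "int k" 1 p] by simp
    then have "1 / real k \<le> N.val p"
      using C by (intro N.le_val good) (auto simp: E_def)
    moreover have "0 < 1 / real k" using \<open>k \<noteq> 0\<close> by simp
    ultimately show ?thesis by linarith
  qed
  ultimately show ?thesis using that by blast
qed

end

section \<open>Baire functions\<close>

text \<open>The boundedness required in \<open>SUP\<close> holds at every point, so all members are
  genuinely real valued. For \<open>n = 0\<close>, \<open>divide\<close> yields the zero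
  function.\<close>

inductive_set baire :: "'a set \<Rightarrow> (('a \<Rightarrow> real) \<Rightarrow> real) set" for A :: "'a set" where
  var: "a \<in> A \<Longrightarrow> (\<lambda>x. x a) \<in> baire A"
| one: "(\<lambda>x. 1) \<in> baire A"
| diff: "f \<in> baire A \<Longrightarrow> g \<in> baire A \<Longrightarrow> (\<lambda>x. f x - g x) \<in> baire A"
| max: "f \<in> baire A \<Longrightarrow> g \<in> baire A \<Longrightarrow> (\<lambda>x. max (f x) (g x)) \<in> baire A"
| divide: "f \<in> baire A \<Longrightarrow> (\<lambda>x. f x / real n) \<in> baire A"
| SUP: "(\<And>n::nat. f n \<in> baire A) \<Longrightarrow> (\<And>x. bdd_above (range (\<lambda>n. f n x))) \<Longrightarrow>
    (\<lambda>x. SUP n. f n x) \<in> baire A"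

lemma baire_zero: "(\<lambda>x. 0) \<in> baire A"
  using baire.diff[OF baire.one baire.one] by simp

lemma baire_uminus: "f \<in> baire A \<Longrightarrow> (\<lambda>x. - f x) \<in> baire A"
  using baire.diff[OF baire_zero] by simp

lemma baire_add: "f \<in> baire A \<Longrightarrow> g \<in> baire A \<Longrightarrow> (\<lambda>x. f x + g x) \<in> baire A"
  using baire.diff[OF _ baire_uminus, of f A g] by simp

lemma baire_min: "f \<in> baire A \<Longrightarrow> g \<in> baire A \<Longrightarrow> (\<lambda>x. min (f x) (g x)) \<in> baire A"
proof -
  assume "f \<in> baire A" "g \<in> baire A"
  then have "(\<lambda>x. (f x + g x) - max (f x) (g x)) \<in> baire A"
    by (intro baire.diff baire_add baire.max)
  moreover have "(f x + g x) - max (f x) (g x) = min (f x) (g x)" for x by (simp add: max_def min_def)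
  ultimately show ?thesis by simp
qed

lemma baire_nmult: "f \<in> baire A \<Longrightarrow> (\<lambda>x. real n * f x) \<in> baire A"
proof (induction n)
  case (Suc n)
  then show ?case using baire_add[of f A "\<lambda>x. real n * f x"] by (simp add: distrib_right)
qed (simp add: baire_zero)

lemma baire_nat: "(\<lambda>x. real n) \<in> baire A"
  using baire_nmult[OF baire.one, of n] by simp

lemmas baire_intros = baire.one baire.diff baire.max baire.divide baire_zero baire_uminus baire_add
  baire_min baire_nmult baire_nat

lemma baire_INF:
  assumes "\<And>n::nat. f n \<in> baire A" "\<And>x. bdd_below (range (\<lambda>n. f n x))"
  shows "(\<lambda>x. INF n. f n x) \<in> baire A"
proof -
  have "bdd_above (range (\<lambda>n. - f n x))" for x
  proof -
    obtain m where "m \<le> f n x" for n using assms(2)[of x] by (auto simp: bdd_below_def)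
    then show ?thesis by (intro bdd_aboveI2[of _ _ "- m"]) simp
  qed
  then have "(\<lambda>x. - (SUP n. - f n x)) \<in> baire A"
    using assms by (intro baire_uminus baire.SUP) auto
  moreover have "- (SUP n. - f n x) = (INF n. f n x)" for x
    by (simp add: Inf_real_def image_image)
  ultimately show ?thesis by simp
qed

section \<open>Cutting a sequence off where it is unbounded\<close>

lemma baire_restrict:
  assumes "g \<in> baire A" and c: "c \<in> baire A" and 01: "\<And>x. c x = 0 \<or> c x = 1"
  shows "(\<lambda>x. if c x = 0 then g x else 0) \<in> baire A"
proof -
  have bdd: "bdd_above (range (\<lambda>j. min (h x) (real j * c x)))" for h :: "('a \<Rightarrow> real) \<Rightarrow> real" and x
    by (rule bdd_aboveI[of _ "h x"]) auto
  \<comment> \<open>The supremum of \<open>min h (j c)\<close> over \<open>j\<close> is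
    \<open>h\<close> where \<open>c = 1\<close> and 0 where \<open>c = 0\<close>, so subtracting it
    from \<open>h\<close> keeps \<open>h\<close> exactly on the zero set of \<open>c\<close>. A
    function of arbitrary sign is treated through its positive and negative parts.\<close>
  have pos: "h x - (SUP j. min (h x) (real j * c x)) = (if c x = 0 then h x else 0)"
    if "h x \<ge> 0" for h :: "('a \<Rightarrow> real) \<Rightarrow> real" and x
  proof (cases "c x = 0")
    case True
    then show ?thesis using that by (simp add: min_def)
  next
    case False
    then have "c x = 1" using 01 by blast
    obtain j where "h x \<le> real j" using real_arch_simple by blast
    then have "(SUP j. min (h x) (real j * c x)) = h x"
      using \<open>c x = 1\<close> by (intro cSup_eq_maximum) (auto intro!: image_eqI[of _ _ j])
    then show ?thesis using \<open>c x = 1\<close> by simp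
  qed
  have "(\<lambda>x. if c x = 0 then h x else 0) \<in> baire A" if "h \<in> baire A" "\<And>x. h x \<ge> 0" for h
  proof -
    have "(\<lambda>x. h x - (SUP j. min (h x) (real j * c x))) \<in> baire A"
      using that c bdd by (intro baire_intros baire.SUP) auto
    then show ?thesis using that pos by simp
  qed
  note restrict = this
  have "(\<lambda>x. max 0 (g x)) \<in> baire A" "(\<lambda>x. max 0 (- g x)) \<in> baire A"
    using assms(1) by (intro baire_intros; assumption)+
  from this[THEN restrict]
  have "(\<lambda>x. (if c x = 0 then max 0 (g x) else 0) - (if c x = 0 then max 0 (- g x) else 0)) \<in> baire A"
    by (intro baire.diff) simp_all
  moreover have "(if c x = 0 then max 0 (g x) else 0) - (if c x = 0 then max 0 (- g x) else 0)
      = (if c x = 0 then g x else 0)" for x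
    by (auto simp: max_def)
  ultimately show ?thesis by simp
qed

text \<open>The indicator of the set where the values \<open>f n x\<close> are unbounded above in
  \<open>n\<close>, in a form built from Baire operations: the inner supremum is constantly 1 if
  they are unbounded, and it vanishes for large \<open>k\<close> if they are bounded.\<close>

definition overflow :: "(nat \<Rightarrow> 'x \<Rightarrow> real) \<Rightarrow> 'x \<Rightarrow> real" where
  "overflow f x = (INF k. SUP n. min 1 (max 0 (f n x - real k)))"

lemma overflow_bdd:
  "bdd_above (range (\<lambda>n. min 1 (max 0 (f n x - real k))))"
  "bdd_below (range (\<lambda>k. SUP n. min 1 (max 0 (f n x - real k))))"
proof -
  show *: "bdd_above (range (\<lambda>n. min 1 (max 0 (f n x - real k))))" for k
    by (rule bdd_aboveI[of _ 1]) auto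
  show "bdd_below (range (\<lambda>k. SUP n. min 1 (max 0 (f n x - real k))))"
    by (rule bdd_belowI[of _ 0]) (auto intro!: cSUP_upper2[OF *, of _ 0])
qed

lemma overflow_baire: "(\<And>n. f n \<in> baire A) \<Longrightarrow> overflow f \<in> baire A"
  unfolding overflow_def[abs_def]
  using overflow_bdd by (intro baire_INF baire.SUP baire_intros) blast+

lemma overflow_eq_0:
  assumes "bdd_above (range (\<lambda>n. f n x))" shows "overflow f x = 0"
proof -
  obtain M where M: "f n x \<le> M" for n using assms by (auto simp: bdd_above_def)
  obtain k where k: "M \<le> real k" using real_arch_simple by blast
  have "f n x - real k \<le> 0" for n using M[of n] k by simp
  then have "(SUP n. min 1 (max 0 (f n x - real k))) = 0" by (simp add: max_absorb1)
  then have "overflow f x \<le> 0"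
    unfolding overflow_def using overflow_bdd(2) by (metis (mono_tags, lifting) cINF_lower UNIV_I)
  moreover have "0 \<le> overflow f x"
    unfolding overflow_def using overflow_bdd(1)
    by (intro cINF_greatest cSUP_upper2[OF overflow_bdd(1), of 0]) auto
  ultimately show ?thesis by simp
qed

lemma overflow_eq_1:
  assumes "\<not> bdd_above (range (\<lambda>n. f n x))" shows "overflow f x = 1"
proof -
  have "(SUP n. min 1 (max 0 (f n x - real k))) = 1" for k
  proof (rule cSup_eq_maximum)
    obtain n where "f n x > real k + 1"
      using assms by (meson bdd_aboveI2 not_le)
    then show "1 \<in> range (\<lambda>n. min 1 (max 0 (f n x - real k)))"
      by (intro image_eqI[of _ _ n]) auto
  qed auto
  then show ?thesis by (simp add: overflow_def)
qed

lemma overflow_0_or_1: "overflow f x = 0 \<or> overflow f x = 1"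
  using overflow_eq_0[of f x] overflow_eq_1[of f x] by (cases "bdd_above (range (\<lambda>n. f n x))") auto

text \<open>The sequence becomes bounded above at every point, which is what the rule
  \<open>SUP\<close> requires, and it is unchanged wherever it was bounded above already.\<close>

lemma baire_finite_part:
  assumes "\<And>n. f n \<in> baire A"
  shows "(\<lambda>x. if overflow f x = 0 then f n x else 0) \<in> baire A"
  using assms overflow_baire[OF assms] overflow_0_or_1 by (rule baire_restrict)

lemma finite_part_bdd: "bdd_above (range (\<lambda>n. if overflow f x = 0 then f n x else 0))"
  using overflow_eq_1[of f x] by (cases "bdd_above (range (\<lambda>n. f n x))") auto

text \<open>Precomposing points with \<open>\<phi>\<close> commutes with every operation that builds
  Baire functions; this is how a morphism acts on them.\<close>

lemma baire_substitute:
  assumes "b \<in> baire A" "\<phi> \<in> A \<rightarrow> B"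
  shows "(\<lambda>y. b (\<lambda>a. y (\<phi> a))) \<in> baire B"
  using assms(1)
proof induction
  case (var a)
  then show ?case using assms(2) by (auto intro: baire.var)
next
  case (SUP f)
  then show ?case by (intro baire.SUP) auto
qed (auto intro: baire.intros)

section \<open>Coding Baire functions by sequences\<close>

definition word_tag :: "'a \<Rightarrow> (nat \<Rightarrow> 'a) \<Rightarrow> nat" where
  "word_tag \<alpha> w = (LEAST j. w (prod_encode (0, j)) = \<alpha>)"

definition word_child :: "(nat \<Rightarrow> 'a) \<Rightarrow> nat \<Rightarrow> nat \<Rightarrow> 'a" where
  "word_child w n j = w (prod_encode (Suc n, j))"

text \<open>Through \<open>prod_encode\<close> a sequence is an infinite array. Row 0 stores the
  number \<open>t\<close> as the first position of the letter \<open>\<alpha>\<close>, and row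
  \<open>Suc n\<close> stores \<open>ws n\<close>; two distinct letters suffice for this.\<close>

lemma ex_word:
  assumes "\<alpha> \<noteq> (\<beta> :: 'a)"
  obtains w where "word_tag \<alpha> w = t" "word_child w = ws"
proof
  define w where "w m = (case prod_decode m of (0, j) \<Rightarrow> if j = t then \<alpha> else \<beta> | (Suc n, j) \<Rightarrow> ws n j)" for m
  show "word_tag \<alpha> w = t"
    unfolding word_tag_def by (rule Least_equality) (use assms in \<open>auto simp: w_def split: if_splits\<close>)
  show "word_child w = ws" by (intro ext) (simp add: word_child_def w_def)
qed

text \<open>A Baire function is built by a well-founded tree with countable branching, and such a tree is
  coded by a single sequence; hence there are no more Baire functions than sequences.\<close>

inductive codes :: "'a \<Rightarrow> (nat \<Rightarrow> 'a) \<Rightarrow> (('a \<Rightarrow> real) \<Rightarrow> real) \<Rightarrow> bool" for \<alpha> :: 'a where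
  "word_tag \<alpha> w = 0 \<Longrightarrow> codes \<alpha> w (\<lambda>x. x (word_child w 0 0))"
| "word_tag \<alpha> w = 1 \<Longrightarrow> codes \<alpha> w (\<lambda>x. 1)"
| "word_tag \<alpha> w = 2 \<Longrightarrow> codes \<alpha> (word_child w 0) f \<Longrightarrow> codes \<alpha> (word_child w 1) g \<Longrightarrow>
    codes \<alpha> w (\<lambda>x. f x - g x)"
| "word_tag \<alpha> w = 3 \<Longrightarrow> codes \<alpha> (word_child w 0) f \<Longrightarrow> codes \<alpha> (word_child w 1) g \<Longrightarrow>
    codes \<alpha> w (\<lambda>x. max (f x) (g x))"
| "word_tag \<alpha> w = 4 \<Longrightarrow> (\<And>n. codes \<alpha> (word_child w n) (fs n)) \<Longrightarrow> codes \<alpha> w (\<lambda>x. SUP n. fs n x)"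
| "word_tag \<alpha> w = n + 5 \<Longrightarrow> codes \<alpha> (word_child w 0) f \<Longrightarrow> codes \<alpha> w (\<lambda>x. f x / real n)"

text \<open>The tag determines the last rule, including the divisor in the case of a quotient, and
  the children determine its arguments. So codes can be decoded, and a choice of codes is
  injective.\<close>

lemma codes_unique: "codes \<alpha> w f \<Longrightarrow> codes \<alpha> w g \<Longrightarrow> f = g"
proof (induction arbitrary: g rule: codes.induct)
  case (5 w fs)
  from \<open>codes \<alpha> w g\<close> show ?case
  proof cases
    case (5 gs)
    then have "fs = gs" using "5.IH" by blast
    then show ?thesis using 5 by simp
  qed (use "5.hyps" in simp_all)
next
  case (3 w f1 f2)
  from \<open>codes \<alpha> w g\<close> show ?case
  proof cases
    case (3 g1 g2)
    then have "f1 = g1" "f2 = g2" using "3.IH" by blast+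
    then show ?thesis using 3(1) by simp
  qed (use "3.hyps" in simp_all)
next
  case (4 w f1 f2)
  from \<open>codes \<alpha> w g\<close> show ?case
  proof cases
    case (4 g1 g2)
    then have "f1 = g1" "f2 = g2" using "4.IH" by blast+
    then show ?thesis using 4(1) by simp
  qed (use "4.hyps" in simp_all)
next
  case (6 w n f)
  from \<open>codes \<alpha> w g\<close> show ?case
  proof cases
    case (6 m f')
    then have "f = f'" "n = m" using "6.IH" "6.hyps" by auto
    then show ?thesis using 6(1) by simp
  qed (use "6.hyps" in simp_all)
next
  case (1 w)
  from \<open>codes \<alpha> w g\<close> show ?case by cases (use "1.hyps" in simp_all)
next
  case (2 w)
  from \<open>codes \<alpha> w g\<close> show ?case by cases (use "2.hyps" in simp_all)
qed

lemma ex_code: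
  assumes "\<alpha> \<noteq> (\<beta> :: 'a)" "f \<in> baire A"
  shows "\<exists>w. codes \<alpha> w f"
  using assms(2)
proof induction
  case (var a)
  obtain w where w: "word_tag \<alpha> w = 0" "word_child w = (\<lambda>_ _. a)"
    by (rule ex_word[OF assms(1), of 0 "\<lambda>_ _. a"])
  from codes.intros(1)[OF w(1)] show ?case by (intro exI[of _ w]) (simp add: w(2))
next
  case one
  obtain w where "word_tag \<alpha> w = (1 :: nat)" by (rule ex_word[OF assms(1), of 1])
  then show ?case by (intro exI codes.intros(2))
next
  case (diff f g)
  then obtain u v where uv: "codes \<alpha> u f" "codes \<alpha> v g" by blast
  obtain w where "word_tag \<alpha> w = 2" "word_child w = (\<lambda>n. if n = 0 then u else v)"
    by (rule ex_word[OF assms(1), of 2])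
  then show ?case using codes.intros(3)[of \<alpha> w f g] uv by auto
next
  case (max f g)
  then obtain u v where uv: "codes \<alpha> u f" "codes \<alpha> v g" by blast
  obtain w where "word_tag \<alpha> w = 3" "word_child w = (\<lambda>n. if n = 0 then u else v)"
    by (rule ex_word[OF assms(1), of 3])
  then show ?case using codes.intros(4)[of \<alpha> w f g] uv by auto
next
  case (divide f n)
  then obtain u where u: "codes \<alpha> u f" by blast
  obtain w where "word_tag \<alpha> w = n + 5" "word_child w = (\<lambda>_. u)"
    by (rule ex_word[OF assms(1), of "n + 5" "\<lambda>_. u"])
  then show ?case using codes.intros(6)[of \<alpha> w n f] u by auto
next
  case (SUP f)
  then obtain ws where ws: "\<And>n. codes \<alpha> (ws n) (f n)" by metis
  obtain w where "word_tag \<alpha> w = 4" "word_child w = ws"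
    by (rule ex_word[OF assms(1), of 4])
  then show ?case using codes.intros(5)[of \<alpha> w f] ws by auto
qed

lemma baire_inj:
  assumes "\<alpha> \<noteq> (\<beta> :: 'a)"
  obtains e :: "(('a \<Rightarrow> real) \<Rightarrow> real) \<Rightarrow> nat \<Rightarrow> 'a" where "inj_on e (baire A)"
proof -
  have "\<exists>e. \<forall>f\<in>baire A. codes \<alpha> (e f) f"
    using ex_code[OF assms] by (intro bchoice) blast
  then obtain e where e: "\<forall>f\<in>baire A. codes \<alpha> (e f) f" by (rule exE)
  have "inj_on e (baire A)"
  proof (rule inj_onI)
    fix f g assume "f \<in> baire A" "g \<in> baire A" "e f = e g"
    then have "codes \<alpha> (e f) f" "codes \<alpha> (e f) g" using e by auto
    then show "f = g" by (rule codes_unique)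
  qed
  then show ?thesis by (rule that)
qed

section \<open>Baire functions modulo almost everywhere equality\<close>

lemma is_lubI:
  assumes "s \<in> carrier L" "\<And>x. x \<in> A \<Longrightarrow> x \<in> carrier L \<Longrightarrow> x \<sqsubseteq>\<^bsub>L\<^esub> s"
    "\<And>u. u \<in> carrier L \<Longrightarrow> (\<And>x. x \<in> A \<Longrightarrow> x \<in> carrier L \<Longrightarrow> x \<sqsubseteq>\<^bsub>L\<^esub> u) \<Longrightarrow> s \<sqsubseteq>\<^bsub>L\<^esub> u"
  shows "is_lub L s A"
  using assms by (auto simp: least_def Upper_def)

lemma is_glbI:
  assumes "s \<in> carrier L" "\<And>x. x \<in> A \<Longrightarrow> x \<in> carrier L \<Longrightarrow> s \<sqsubseteq>\<^bsub>L\<^esub> x"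
    "\<And>u. u \<in> carrier L \<Longrightarrow> (\<And>x. x \<in> A \<Longrightarrow> x \<in> carrier L \<Longrightarrow> u \<sqsubseteq>\<^bsub>L\<^esub> x) \<Longrightarrow> u \<sqsubseteq>\<^bsub>L\<^esub> s"
  shows "is_glb L s A"
  using assms by (auto simp: greatest_def Lower_def)

lemma is_lub_upper: "is_lub L s A \<Longrightarrow> x \<in> A \<Longrightarrow> x \<in> carrier L \<Longrightarrow> x \<sqsubseteq>\<^bsub>L\<^esub> s"
  by (auto simp: least_def Upper_def)

lemma is_lub_least:
  "is_lub L s A \<Longrightarrow> u \<in> carrier L \<Longrightarrow> (\<And>x. x \<in> A \<Longrightarrow> x \<in> carrier L \<Longrightarrow> x \<sqsubseteq>\<^bsub>L\<^esub> u) \<Longrightarrow> s \<sqsubseteq>\<^bsub>L\<^esub> u"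
  by (auto simp: least_def Upper_def)

lemma is_lub_closed: "is_lub L s A \<Longrightarrow> s \<in> carrier L"
  by (auto simp: least_def Upper_def)

text \<open>\<open>q\<close> names the classes of Baire functions which agree almost everywhere with respect to \<open>F\<close>.\<close>

locale baire_quotient =
  fixes A :: "'a set" and F :: "('a \<Rightarrow> real) filter" and q :: "(('a \<Rightarrow> real) \<Rightarrow> real) \<Rightarrow> 'q"
  assumes ae_all: "(\<And>n::nat. eventually (P n) F) \<Longrightarrow> eventually (\<lambda>x. \<forall>n. P n x) F"
    and q_eq_iff: "f \<in> baire A \<Longrightarrow> g \<in> baire A \<Longrightarrow> q f = q g \<longleftrightarrow> eventually (\<lambda>x. f x = g x) F"
begin

definition rep :: "'q \<Rightarrow> ('a \<Rightarrow> real) \<Rightarrow> real" where "rep = inv_into (baire A) q"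

definition Q :: "'q wstruct" where
  "Q = \<lparr>carrier = q ` baire A, eq = (=), le = (\<lambda>z w. eventually (\<lambda>x. rep z x \<le> rep w x) F),
     wadd = (\<lambda>z w. q (\<lambda>x. rep z x + rep w x)), wzero = q (\<lambda>x. 0), wunit = q (\<lambda>x. 1)\<rparr>"

lemma carrier_Q: "carrier Q = q ` baire A"
  and wzero_Q: "wzero Q = q (\<lambda>x. 0)" and wunit_Q: "wunit Q = q (\<lambda>x. 1)"
  by (simp_all add: Q_def)

lemma q_closed [simp]: "f \<in> baire A \<Longrightarrow> q f \<in> carrier Q"
  by (simp add: carrier_Q)

lemma rep_baire: "z \<in> carrier Q \<Longrightarrow> rep z \<in> baire A"
  and q_rep [simp]: "z \<in> carrier Q \<Longrightarrow> q (rep z) = z"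
  by (auto simp: rep_def carrier_Q inv_into_into f_inv_into_f)

lemma ae_rep: "f \<in> baire A \<Longrightarrow> eventually (\<lambda>x. rep (q f) x = f x) F"
  using q_eq_iff[of "rep (q f)" f] rep_baire by simp

lemma le_Q: 
  assumes "f \<in> baire A" "g \<in> baire A"
  shows "q f \<sqsubseteq>\<^bsub>Q\<^esub> q g \<longleftrightarrow> eventually (\<lambda>x. f x \<le> g x) F"
proof -
  have "eventually (\<lambda>x. rep (q f) x \<le> rep (q g) x \<longleftrightarrow> f x \<le> g x) F"
    using ae_rep[OF assms(1)] ae_rep[OF assms(2)] by eventually_elim simp
  then show ?thesis by (simp add: Q_def eventually_subst)
qed

lemma le_Q_I: "f \<in> baire A \<Longrightarrow> g \<in> baire A \<Longrightarrow> (\<And>x. f x \<le> g x) \<Longrightarrow> q f \<sqsubseteq>\<^bsub>Q\<^esub> q g"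
  by (simp add: le_Q)

lemma add_Q:
  assumes "f \<in> baire A" "g \<in> baire A"
  shows "wadd Q (q f) (q g) = q (\<lambda>x. f x + g x)"
proof -
  have "eventually (\<lambda>x. rep (q f) x + rep (q g) x = f x + g x) F"
    using ae_rep[OF assms(1)] ae_rep[OF assms(2)] by eventually_elim simp
  then show ?thesis
    using assms by (simp add: Q_def q_eq_iff baire_add rep_baire[unfolded carrier_Q])
qed

lemma Q_cases:
  assumes "z \<in> carrier Q" obtains f where "f \<in> baire A" "z = q f"
  using assms by (auto simp: carrier_Q)

lemma partial_order_Q: "partial_order Q"
proof -
  have eq: "(.=\<^bsub>Q\<^esub>) = (=)" by (simp add: Q_def)
  show ?thesis
  proof (unfold_locales, goal_cases)
    case (5 x y)
    then obtain f g where fg: "f \<in> baire A" "x = q f" "g \<in> baire A" "y = q g" by (auto elim!: Q_cases)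
    have "eventually (\<lambda>x. f x \<le> g x) F" "eventually (\<lambda>x. g x \<le> f x) F"
      using 5 fg by (auto simp: le_Q)
    then have "eventually (\<lambda>x. f x = g x) F" by eventually_elim simp
    then show ?case using fg by (simp add: q_eq_iff eq)
  next
    case (6 x y z)
    then obtain f g h where fgh: "f \<in> baire A" "x = q f" "g \<in> baire A" "y = q g" "h \<in> baire A" "z = q h"
      by (auto elim!: Q_cases)
    have "eventually (\<lambda>x. f x \<le> g x) F" "eventually (\<lambda>x. g x \<le> h x) F"
      using 6 fgh by (auto simp: le_Q)
    then have "eventually (\<lambda>x. f x \<le> h x) F" by eventually_elim simp
    then show ?case using fgh by (simp add: le_Q)
  qed (auto simp: eq elim!: Q_cases simp: le_Q)
qed

lemma lub_pair_Q:
  assumes "f \<in> baire A" "g \<in> baire A"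
  shows "is_lub Q (q (\<lambda>x. max (f x) (g x))) {q f, q g}"
proof (rule is_lubI)
  fix u assume u: "u \<in> carrier Q" "\<And>x. x \<in> {q f, q g} \<Longrightarrow> x \<in> carrier Q \<Longrightarrow> x \<sqsubseteq>\<^bsub>Q\<^esub> u"
  obtain h where h: "h \<in> baire A" "u = q h" using u(1) by (rule Q_cases)
  have "eventually (\<lambda>x. f x \<le> h x) F" "eventually (\<lambda>x. g x \<le> h x) F"
    using u(2)[of "q f"] u(2)[of "q g"] h assms by (auto simp: le_Q)
  then have "eventually (\<lambda>x. max (f x) (g x) \<le> h x) F" by eventually_elim simp
  then show "q (\<lambda>x. max (f x) (g x)) \<sqsubseteq>\<^bsub>Q\<^esub> u" using h assms by (simp add: le_Q baire_intros)
qed (use assms in \<open>auto simp: baire_intros intro!: le_Q_I\<close>)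

lemma glb_pair_Q:
  assumes "f \<in> baire A" "g \<in> baire A"
  shows "is_glb Q (q (\<lambda>x. min (f x) (g x))) {q f, q g}"
proof (rule is_glbI)
  fix u assume u: "u \<in> carrier Q" "\<And>x. x \<in> {q f, q g} \<Longrightarrow> x \<in> carrier Q \<Longrightarrow> u \<sqsubseteq>\<^bsub>Q\<^esub> x"
  obtain h where h: "h \<in> baire A" "u = q h" using u(1) by (rule Q_cases)
  have "eventually (\<lambda>x. h x \<le> f x) F" "eventually (\<lambda>x. h x \<le> g x) F"
    using u(2)[of "q f"] u(2)[of "q g"] h assms by (auto simp: le_Q)
  then have "eventually (\<lambda>x. h x \<le> min (f x) (g x)) F" by eventually_elim simp
  then show "u \<sqsubseteq>\<^bsub>Q\<^esub> q (\<lambda>x. min (f x) (g x))" using h assms by (simp add: le_Q baire_intros)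
qed (use assms in \<open>auto simp: baire_intros intro!: le_Q_I\<close>)

lemma lattice_Q: "Lattice.lattice Q"
proof -
  interpret partial_order Q by (rule partial_order_Q)
  show ?thesis
    by unfold_locales (auto elim!: Q_cases intro: lub_pair_Q glb_pair_Q)
qed

lemma join_Q: "f \<in> baire A \<Longrightarrow> g \<in> baire A \<Longrightarrow> q f \<squnion>\<^bsub>Q\<^esub> q g = q (\<lambda>x. max (f x) (g x))"
  by (intro lub_pair_join lattice_Q lub_pair_Q) auto

lemma meet_Q: "f \<in> baire A \<Longrightarrow> g \<in> baire A \<Longrightarrow> q f \<sqinter>\<^bsub>Q\<^esub> q g = q (\<lambda>x. min (f x) (g x))"
  by (intro glb_pair_meet lattice_Q glb_pair_Q) auto

lemma comm_group_Q: "comm_group (add_grp Q)"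
proof (rule comm_groupI)
  fix z assume "z \<in> carrier (add_grp Q)"
  then obtain f where f: "f \<in> baire A" "z = q f" by (auto elim: Q_cases)
  then show "\<exists>w\<in>carrier (add_grp Q). w \<otimes>\<^bsub>add_grp Q\<^esub> z = \<one>\<^bsub>add_grp Q\<^esub>"
    by (intro bexI[of _ "q (\<lambda>x. - f x)"]) (auto simp: add_Q wzero_Q baire_intros)
qed (auto elim!: Q_cases simp: add_Q wzero_Q baire_intros add_ac)

lemma nat_pow_Q:
  assumes "f \<in> baire A" shows "q f [^]\<^bsub>add_grp Q\<^esub> (n::nat) = q (\<lambda>x. real n * f x)"
proof (induction n)
  case 0
  then show ?case by (simp add: wzero_Q)
next
  case (Suc n)
  then show ?case using assms by (simp add: add_Q baire_intros distrib_right add.commute)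
qed

lemma W_object_Q: "W_object Q"
proof (intro W_object.intro W_object_axioms.intro lattice_Q comm_group_Q)
  fix x y z assume "x \<in> carrier Q" "y \<in> carrier Q" "z \<in> carrier Q" "x \<sqsubseteq>\<^bsub>Q\<^esub> y"
  then show "wadd Q x z \<sqsubseteq>\<^bsub>Q\<^esub> wadd Q y z"
    by (auto elim!: Q_cases simp: le_Q add_Q baire_intros)
next
  fix x y assume xy: "x \<in> carrier Q" "y \<in> carrier Q" "wzero Q \<sqsubseteq>\<^bsub>Q\<^esub> x"
    "\<And>n::nat. x [^]\<^bsub>add_grp Q\<^esub> n \<sqsubseteq>\<^bsub>Q\<^esub> y"
  then obtain f g where fg: "f \<in> baire A" "x = q f" "g \<in> baire A" "y = q g" by (auto elim!: Q_cases)
  have "eventually (\<lambda>x. 0 \<le> f x) F" using xy fg by (simp add: wzero_Q le_Q baire_zero)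
  moreover have "eventually (\<lambda>x. real n * f x \<le> g x) F" for n
    using xy(4)[of n] fg by (simp add: nat_pow_Q le_Q baire_intros)
  \<comment> \<open>Since \<open>F\<close> is closed under countable intersections, the inequalities
    hold simultaneously for almost every point, where the archimedean property of the reals
    applies.\<close>
  then have "eventually (\<lambda>x. \<forall>n. real n * f x \<le> g x) F" by (rule ae_all)
  ultimately have "eventually (\<lambda>x. f x = 0) F"
  proof eventually_elim
    case (elim x)
    show ?case
    proof (rule ccontr)
      assume "f x \<noteq> 0"
      then have "0 < f x" using elim by simp
      then obtain n where "g x < real n * f x" using reals_Archimedean3 by blast
      then show False using elim by (metis not_le)
    qed
  qed
  then show "x = wzero Q" using fg by (simp add: wzero_Q q_eq_iff baire_zero)
next
  fix x assume x: "x \<in> carrier Q" "x \<sqinter>\<^bsub>Q\<^esub> wunit Q = wzero Q"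
  then obtain f where f: "f \<in> baire A" "x = q f" by (auto elim!: Q_cases)
  then have "eventually (\<lambda>x. min (f x) 1 = 0) F"
    using x by (simp add: wzero_Q wunit_Q meet_Q baire_intros q_eq_iff)
  then have "eventually (\<lambda>x. f x = 0) F" by eventually_elim (auto simp: min_def split: if_splits)
  then show "x = wzero Q" using f by (simp add: wzero_Q q_eq_iff baire_zero)
qed (auto simp: wzero_Q wunit_Q le_Q baire_intros)

lemma divisible_Q: "divisible Q"
  unfolding divisible_def
proof (intro ballI allI impI)
  fix z and n :: nat assume "z \<in> carrier Q" "0 < n"
  then obtain f where "f \<in> baire A" "z = q f" by (auto elim!: Q_cases)
  then show "\<exists>x\<in>carrier Q. x [^]\<^bsub>add_grp Q\<^esub> n = z"
    using \<open>0 < n\<close> by (intro bexI[of _ "q (\<lambda>x. f x / real n)"]) (auto simp: nat_pow_Q baire_intros)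
qed

end

section \<open>Countable suprema are pointwise joins\<close>

lemma (in W_object) trivial_if_unit_zero:
  assumes "wunit G = \<zero>" "x \<in> carrier G" shows "x = \<zero>"
proof -
  have nonpos: "y \<sqsubseteq> \<zero>" if y: "y \<in> carrier G" for y
  proof -
    have "\<zero> \<sqsubseteq> y \<squnion> \<zero>" using y by (simp add: join_right)
    moreover from this have "(y \<squnion> \<zero>) \<sqinter> \<zero> = \<zero>"
      using y by (intro le_antisym meet_le) (auto simp: meet_right)
    ultimately have "y \<squnion> \<zero> = \<zero>" using weak_unit[of "y \<squnion> \<zero>"] y assms by simp
    then show ?thesis using join_left[of y \<zero>] y by simp
  qed
  have "x \<sqsubseteq> \<zero>" "\<zero> \<sqsubseteq> x"
    using nonpos[of x] nonpos[of "\<ominus> x"] diff_le_iff[of \<zero> \<zero> x] assms by auto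
  then show ?thesis using assms by (intro le_antisym) auto
qed

text \<open>A supremum depends only on the set of upper bounds, so suprema of images of a countably
  generated downset can be computed from the generators.\<close>

lemma Upper_image_down:
  assumes "W_object G" "W_object H" "\<theta> \<in> W_hom G H" "K \<subseteq> carrier G"
  shows "Upper H (\<theta> ` {g \<in> carrier G. \<exists>k\<in>K. g \<sqsubseteq>\<^bsub>G\<^esub> k}) = Upper H (\<theta> ` K)"
proof -
  interpret G: W_object G by fact
  interpret H: W_object H by fact
  have cl: "\<theta> x \<in> carrier H" if "x \<in> carrier G" for x using W_hom_closed[OF assms(3) that] .
  have le: "\<theta> g \<sqsubseteq>\<^bsub>H\<^esub> u"
    if "g \<in> carrier G" "k \<in> K" "g \<sqsubseteq>\<^bsub>G\<^esub> k" "\<theta> k \<sqsubseteq>\<^bsub>H\<^esub> u" "u \<in> carrier H" for g k u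
  proof -
    have k: "k \<in> carrier G" using that assms(4) by blast
    have "\<theta> g \<sqsubseteq>\<^bsub>H\<^esub> \<theta> k" using that k by (intro W_hom_mono[OF assms(1-3)])
    then show ?thesis using that(4) cl[OF that(1)] cl[OF k] that(5) by (rule H.le_trans)
  qed
  show ?thesis
  proof (rule subset_antisym)
    have "K \<subseteq> {g \<in> carrier G. \<exists>k\<in>K. g \<sqsubseteq>\<^bsub>G\<^esub> k}"
      using assms(4) by (auto intro!: bexI[rotated] G.le_refl)
    then show "Upper H (\<theta> ` {g \<in> carrier G. \<exists>k\<in>K. g \<sqsubseteq>\<^bsub>G\<^esub> k}) \<subseteq> Upper H (\<theta> ` K)"
      by (intro Upper_antimono image_mono)
    show "Upper H (\<theta> ` K) \<subseteq> Upper H (\<theta> ` {g \<in> carrier G. \<exists>k\<in>K. g \<sqsubseteq>\<^bsub>G\<^esub> k})"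
    proof
      fix u assume "u \<in> Upper H (\<theta> ` K)"
      then have u: "u \<in> carrier H" "\<theta> k \<sqsubseteq>\<^bsub>H\<^esub> u" if "k \<in> K" for k
        using that cl assms(4) by (auto simp: Upper_def)
      have "u \<in> carrier H" using \<open>u \<in> Upper H (\<theta> ` K)\<close> by (simp add: Upper_def)
      then show "u \<in> Upper H (\<theta> ` {g \<in> carrier G. \<exists>k\<in>K. g \<sqsubseteq>\<^bsub>G\<^esub> k})"
        using le u(2) by (auto simp: Upper_def)
    qed
  qed
qed

context baire_quotient
begin

section \<open>Morphisms out of the quotient\<close>

context
  fixes H :: "'h wstruct" and \<theta>
  assumes H: "W_object H" and \<theta>: "\<theta> \<in> W_hom Q H"
begin

interpretation H: W_object H by (rule H)

lemma hom_closed: "f \<in> baire A \<Longrightarrow> \<theta> (q f) \<in> carrier H"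
  by (intro W_hom_closed[OF \<theta>]) simp

lemma hom_mono: "f \<in> baire A \<Longrightarrow> g \<in> baire A \<Longrightarrow> (\<And>x. f x \<le> g x) \<Longrightarrow> \<theta> (q f) \<sqsubseteq>\<^bsub>H\<^esub> \<theta> (q g)"
  by (intro W_hom_mono[OF W_object_Q H \<theta>] le_Q_I) auto

lemma hom_add: "f \<in> baire A \<Longrightarrow> g \<in> baire A \<Longrightarrow> \<theta> (q (\<lambda>x. f x + g x)) = wadd H (\<theta> (q f)) (\<theta> (q g))"
  using \<theta> by (auto simp: W_hom_def hom_def add_Q[symmetric])

lemma hom_max: "f \<in> baire A \<Longrightarrow> g \<in> baire A \<Longrightarrow> \<theta> (q (\<lambda>x. max (f x) (g x))) = \<theta> (q f) \<squnion>\<^bsub>H\<^esub> \<theta> (q g)"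
  using \<theta> by (auto simp: W_hom_def join_Q[symmetric])

lemma hom_min: "f \<in> baire A \<Longrightarrow> g \<in> baire A \<Longrightarrow> \<theta> (q (\<lambda>x. min (f x) (g x))) = \<theta> (q f) \<sqinter>\<^bsub>H\<^esub> \<theta> (q g)"
  using \<theta> by (auto simp: W_hom_def meet_Q[symmetric])

lemma hom_zero: "\<theta> (q (\<lambda>x. 0)) = wzero H"
  using W_hom_zero[OF W_object_Q H \<theta>] by (simp add: wzero_Q)

lemma hom_unit: "\<theta> (q (\<lambda>x. 1)) = wunit H"
  using \<theta> by (simp add: W_hom_def wunit_Q)

lemma hom_nmult: "f \<in> baire A \<Longrightarrow> \<theta> (q (\<lambda>x. real n * f x)) = \<theta> (q f) [^]\<^bsub>add_grp H\<^esub> n"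
proof (induction n)
  case 0
  then show ?case by (simp add: hom_zero)
next
  case (Suc n)
  then show ?case
    using hom_add[of "\<lambda>x. real n * f x" f] by (simp add: baire_intros distrib_right add.commute)
qed

text \<open>The remainders \<open>u m\<close> decrease to 0 everywhere, so for each \<open>k\<close> the function \<open>g\<close> below is
  everywhere finite; that \<open>m \<cdot> min ((k u m - 1)\<^sup>+) 1 \<le> g\<close> for all \<open>m\<close> survives every morphism, and
  in the codomain the archimedean property turns it into convergence.\<close>

lemma incseq_SUP_le:
  assumes f: "\<And>n. f n \<in> baire A" and inc: "\<And>x. incseq (\<lambda>n. f n x)"
    and bdd: "\<And>x. bdd_above (range (\<lambda>n. f n x))"
    and h: "h \<in> carrier H" "\<And>n. \<theta> (q (f n)) \<sqsubseteq>\<^bsub>H\<^esub> h"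
  shows "\<theta> (q (\<lambda>x. SUP n. f n x)) \<sqsubseteq>\<^bsub>H\<^esub> h"
proof -
  define s where "s x = (SUP n. f n x)" for x
  define u where "u m x = s x - f m x" for m x
  have s: "s \<in> baire A" unfolding s_def[abs_def] by (rule baire.SUP[OF f bdd])
  then have u: "u m \<in> baire A" for m unfolding u_def[abs_def] using f by (intro baire.diff)
  have f_le: "f m x \<le> s x" for m x unfolding s_def using bdd by (intro cSUP_upper) auto
  \<comment> \<open>The claim amounts to \<open>d = 0\<close> for the positive part \<open>d\<close>
    of the excess of the image of \<open>s\<close> over \<open>h\<close>. This \<open>d\<close> lies
    below the image of every remainder \<open>u m\<close>.\<close>
  define d where "d = (wadd H (\<theta> (q s)) (inv\<^bsub>add_grp H\<^esub> h)) \<squnion>\<^bsub>H\<^esub> wzero H"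
  have c: "\<theta> (q s) \<in> carrier H" "\<theta> (q (u m)) \<in> carrier H" "\<theta> (q (f m)) \<in> carrier H" for m
    using s u f hom_closed by auto
  have d: "d \<in> carrier H" "wzero H \<sqsubseteq>\<^bsub>H\<^esub> d" using c h by (simp_all add: d_def H.join_right)
  have d_le: "d \<sqsubseteq>\<^bsub>H\<^esub> \<theta> (q (u m))" for m
  proof -
    have "(\<lambda>x. u m x + f m x) = s" by (simp add: u_def)
    then have "\<theta> (q s) = wadd H (\<theta> (q (u m))) (\<theta> (q (f m)))"
      using hom_add[OF u f, of m m] by simp
    also have "\<dots> \<sqsubseteq>\<^bsub>H\<^esub> wadd H (\<theta> (q (u m))) h"
      using c h by (intro H.add_mono2) auto
    finally have "wadd H (\<theta> (q s)) (inv\<^bsub>add_grp H\<^esub> h) \<sqsubseteq>\<^bsub>H\<^esub> \<theta> (q (u m))"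
      using c h by (simp add: H.diff_le_iff)
    moreover have "wzero H \<sqsubseteq>\<^bsub>H\<^esub> \<theta> (q (u m))"
      using hom_mono[OF baire_zero u] f_le by (simp add: hom_zero u_def)
    ultimately show ?thesis using c h unfolding d_def by (intro H.join_le) auto
  qed
  \<comment> \<open>Archimedeanity reduces \<open>d = 0\<close> to \<open>k d \<le> 1\<close> for
    every \<open>k\<close>, that is, to the vanishing of the element \<open>e = (k d - 1)^+\<close>
    defined below.\<close>
  have "d [^]\<^bsub>add_grp H\<^esub> k \<sqsubseteq>\<^bsub>H\<^esub> wunit H" for k :: nat
  proof -
    define v where "v m x = min (max (real k * u m x - 1) 0) 1" for m x
    have v: "v m \<in> baire A" for m unfolding v_def[abs_def] using u by (intro baire_intros)
    define g where "g x = (SUP m. real m * v m x)" for x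
    have g_bdd: "bdd_above (range (\<lambda>m. real m * v m x))" for x
    proof -
      \<comment> \<open>From index \<open>M\<close> on, \<open>k u m x \<le> 1\<close> and hence
        \<open>v m x = 0\<close>; the earlier terms are at most \<open>M\<close> because
        \<open>v\<close> is at most 1.\<close>
      obtain M where M: "real k * u M x \<le> 1"
      proof (cases "k = 0")
        case False
        then have "s x - 1 / real k < s x" by simp
        then obtain M where "s x - 1 / real k < f M x"
          unfolding s_def using less_cSUP_iff[OF _ bdd] by auto
        then have "real k * u M x \<le> 1" using False by (simp add: u_def field_simps)
        then show ?thesis by (rule that)
      qed (use that in auto)
      have "real m * v m x \<le> real M" for m
      proof (cases "m \<le> M")
        case True
        have "real m * v m x \<le> real m * 1" by (intro mult_left_mono) (auto simp: v_def)
        then show ?thesis using True by simp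
      next
        case False
        then have "u m x \<le> u M x" using incseqD[OF inc, of M m x] by (simp add: u_def)
        then have "real k * u m x \<le> 1" using M by (meson mult_left_mono of_nat_0_le_iff order_trans)
        then show ?thesis by (simp add: v_def)
      qed
      then show ?thesis by (rule bdd_aboveI2)
    qed
    have g: "g \<in> baire A" unfolding g_def[abs_def] using v g_bdd by (intro baire.SUP baire_nmult)
    define e where "e = (wadd H (d [^]\<^bsub>add_grp H\<^esub> k) (inv\<^bsub>add_grp H\<^esub> wunit H)) \<squnion>\<^bsub>H\<^esub> wzero H"
    have e: "e \<in> carrier H" "wzero H \<sqsubseteq>\<^bsub>H\<^esub> e"
      using d H.unit_closed by (simp_all add: e_def H.join_right)
    have e_le: "e \<sqinter>\<^bsub>H\<^esub> wunit H \<sqsubseteq>\<^bsub>H\<^esub> \<theta> (q (v m))" for m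
    proof -
      let ?a = "\<lambda>x. real k * u m x - 1"
      have a: "?a \<in> baire A" using u by (intro baire_intros)
      have "wadd H (\<theta> (q ?a)) (wunit H) = \<theta> (q (u m)) [^]\<^bsub>add_grp H\<^esub> k"
        using hom_add[OF a baire.one] u by (simp add: hom_unit hom_nmult)
      moreover have "d [^]\<^bsub>add_grp H\<^esub> k \<sqsubseteq>\<^bsub>H\<^esub> \<theta> (q (u m)) [^]\<^bsub>add_grp H\<^esub> k"
        using d c d_le by (intro H.nmul_mono)
      ultimately have "wadd H (d [^]\<^bsub>add_grp H\<^esub> k) (inv\<^bsub>add_grp H\<^esub> wunit H) \<sqsubseteq>\<^bsub>H\<^esub> \<theta> (q ?a)"
        using d a H.unit_closed hom_closed by (simp add: H.diff_le_iff)
      moreover have ac: "\<theta> (q ?a) \<in> carrier H" using a by (rule hom_closed)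
      ultimately have "e \<sqsubseteq>\<^bsub>H\<^esub> \<theta> (q ?a) \<squnion>\<^bsub>H\<^esub> wzero H"
        unfolding e_def using d H.unit_closed
        by (intro H.join_le) (auto intro: H.le_trans[OF _ H.join_left] simp: H.join_right)
      then have "e \<sqinter>\<^bsub>H\<^esub> wunit H \<sqsubseteq>\<^bsub>H\<^esub> (\<theta> (q ?a) \<squnion>\<^bsub>H\<^esub> wzero H) \<sqinter>\<^bsub>H\<^esub> wunit H"
        using e ac H.unit_closed
        by (intro H.meet_le) (auto intro: H.le_trans[OF H.meet_left] simp: H.meet_right)
      also have "\<dots> = \<theta> (q (v m))"
        unfolding v_def[abs_def] using a
        by (subst hom_min) (auto simp: hom_max hom_zero hom_unit baire_intros)
      finally show ?thesis .
    qed
    let ?w = "e \<sqinter>\<^bsub>H\<^esub> wunit H"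
    \<comment> \<open>All multiples \<open>m ?w\<close> lie below the image of the single element
      \<open>g\<close>, so archimedeanity gives \<open>?w = 0\<close>; then \<open>e = 0\<close> by
      weakness of the unit.\<close>
    have "?w = wzero H"
    proof (rule H.archimedean)
      show "?w \<in> carrier H" using e H.unit_closed by simp
      show "\<theta> (q g) \<in> carrier H" using g by (rule hom_closed)
      show "wzero H \<sqsubseteq>\<^bsub>H\<^esub> ?w" using e H.unit_closed H.unit_nonneg by (intro H.meet_le) auto
      fix m :: nat
      have "?w [^]\<^bsub>add_grp H\<^esub> m \<sqsubseteq>\<^bsub>H\<^esub> \<theta> (q (v m)) [^]\<^bsub>add_grp H\<^esub> m"
        using e e_le H.unit_closed hom_closed[OF v] by (intro H.nmul_mono) auto
      also have "\<dots> = \<theta> (q (\<lambda>x. real m * v m x))" using v by (simp add: hom_nmult)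
      finally have "?w [^]\<^bsub>add_grp H\<^esub> m \<sqsubseteq>\<^bsub>H\<^esub> \<theta> (q (\<lambda>x. real m * v m x))" .
      moreover have "\<theta> (q (\<lambda>x. real m * v m x)) \<sqsubseteq>\<^bsub>H\<^esub> \<theta> (q g)"
        using v g unfolding g_def by (intro hom_mono baire_nmult cSUP_upper g_bdd) (auto simp: g_def[abs_def])
      ultimately show "?w [^]\<^bsub>add_grp H\<^esub> m \<sqsubseteq>\<^bsub>H\<^esub> \<theta> (q g)"
        by (rule H.le_trans) (use e H.unit_closed hom_closed[OF baire_nmult[OF v[of m], of m]] hom_closed[OF g] in auto)
    qed
    then have "e = wzero H" using H.weak_unit e by blast
    then have "wadd H (d [^]\<^bsub>add_grp H\<^esub> k) (inv\<^bsub>add_grp H\<^esub> wunit H) \<sqsubseteq>\<^bsub>H\<^esub> wzero H"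
      using H.join_left[of "wadd H (d [^]\<^bsub>add_grp H\<^esub> k) (inv\<^bsub>add_grp H\<^esub> wunit H)" "wzero H"]
        d H.unit_closed by (simp add: e_def)
    then show ?thesis using d H.unit_closed by (simp add: H.diff_le_iff)
  qed
  then have "d = wzero H" using d H.unit_closed by (intro H.archimedean[of d "wunit H"])
  then have "wadd H (\<theta> (q s)) (inv\<^bsub>add_grp H\<^esub> h) \<sqsubseteq>\<^bsub>H\<^esub> wzero H"
    using H.join_left[of "wadd H (\<theta> (q s)) (inv\<^bsub>add_grp H\<^esub> h)" "wzero H"] c h by (simp add: d_def)
  then have "\<theta> (q s) \<sqsubseteq>\<^bsub>H\<^esub> h" using c h by (simp add: H.diff_le_iff)
  then show ?thesis by (simp add: s_def[abs_def])
qed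

primrec running_max :: "(nat \<Rightarrow> 'x \<Rightarrow> real) \<Rightarrow> nat \<Rightarrow> 'x \<Rightarrow> real" where
  "running_max f 0 = f 0"
| "running_max f (Suc n) = (\<lambda>x. max (running_max f n x) (f (Suc n) x))"

text \<open>The running maxima increase to the same supremum, and since morphisms preserve binary
  joins, every upper bound of the images of \<open>f n\<close> bounds the images of the running
  maxima too. So \<open>incseq_SUP_le\<close> applies.\<close>

theorem SUP_is_lub:
  assumes f: "\<And>n::nat. f n \<in> baire A" and bdd: "\<And>x. bdd_above (range (\<lambda>n. f n x))"
  shows "is_lub H (\<theta> (q (\<lambda>x. SUP n. f n x))) (range (\<lambda>n. \<theta> (q (f n))))"
proof (rule is_lubI)
  have s: "(\<lambda>x. SUP n. f n x) \<in> baire A" by (rule baire.SUP[OF f bdd])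
  then show "\<theta> (q (\<lambda>x. SUP n. f n x)) \<in> carrier H" by (rule hom_closed)
  fix h assume h: "h \<in> carrier H"
    "\<And>x. x \<in> range (\<lambda>n. \<theta> (q (f n))) \<Longrightarrow> x \<in> carrier H \<Longrightarrow> x \<sqsubseteq>\<^bsub>H\<^esub> h"
  let ?m = "running_max f"
  have m: "?m n \<in> baire A" for n by (induction n) (auto intro: f baire.max)
  have inc: "incseq (\<lambda>n. ?m n x)" for x by (rule incseq_SucI) simp
  have upper: "f n x \<le> ?m n x" for n x by (cases n) auto
  have least: "?m n x \<le> M" if "\<And>n. f n x \<le> M" for n x M by (induction n) (use that in auto)
  have m_bdd: "bdd_above (range (\<lambda>n. ?m n x))" for x
    using bdd[of x] least[of x] by (auto simp: bdd_above_def)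
  have "(SUP n. ?m n x) = (SUP n. f n x)" for x
  proof (rule antisym)
    show "(SUP n. ?m n x) \<le> (SUP n. f n x)"
      using bdd[of x] by (intro cSUP_least least) (auto intro: cSUP_upper)
    show "(SUP n. f n x) \<le> (SUP n. ?m n x)"
      using m_bdd[of x] upper by (intro cSUP_mono) auto
  qed
  moreover have "\<theta> (q (\<lambda>x. SUP n. ?m n x)) \<sqsubseteq>\<^bsub>H\<^esub> h"
  proof (rule incseq_SUP_le[OF m inc m_bdd h(1)])
    fix n show "\<theta> (q (?m n)) \<sqsubseteq>\<^bsub>H\<^esub> h"
    proof (induction n)
      case (Suc n)
      then show ?case using h f m hom_closed by (auto simp: hom_max intro!: H.join_le)
    qed (use h f hom_closed in auto)
  qed
  ultimately show "\<theta> (q (\<lambda>x. SUP n. f n x)) \<sqsubseteq>\<^bsub>H\<^esub> h" by simp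
next
  fix z assume "z \<in> range (\<lambda>n. \<theta> (q (f n)))"
  then show "z \<sqsubseteq>\<^bsub>H\<^esub> \<theta> (q (\<lambda>x. SUP n. f n x))"
    using f bdd by (auto intro!: hom_mono baire.SUP cSUP_upper)
qed

text \<open>An upper bound \<open>s\<close> in any extension keeps the supremum finite almost everywhere, since
  \<open>k \<cdot> overflow f \<le> s\<^sup>+\<close> there for all \<open>k\<close>.\<close>

lemma ae_overflow_eq_0:
  assumes inj: "inj_on \<theta> (carrier Q)" and f: "\<And>n. f n \<in> baire A"
    and s: "s \<in> carrier H" "\<And>n. \<theta> (q (f n)) \<sqsubseteq>\<^bsub>H\<^esub> s"
  shows "eventually (\<lambda>x. overflow f x = 0) F"
proof -
  have o: "overflow f \<in> baire A" using f by (rule overflow_baire)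
  have "\<theta> (q (overflow f)) = wzero H"
  proof (rule H.archimedean)
    show "\<theta> (q (overflow f)) \<in> carrier H" using o by (rule hom_closed)
    show "s \<squnion>\<^bsub>H\<^esub> wzero H \<in> carrier H" using s by simp
    have "0 \<le> overflow f x" for x using overflow_0_or_1[of f x] by auto
    then show "wzero H \<sqsubseteq>\<^bsub>H\<^esub> \<theta> (q (overflow f))"
      using hom_mono[OF baire_zero o] by (simp add: hom_zero)
    fix k :: nat
    \<comment> \<open>\<open>g n\<close> is at most \<open>k\<close> and vanishes unless
      \<open>f n x > k\<close>, so it lies below \<open>(f n)^+\<close>; yet the supremum of the
      \<open>g n\<close> dominates \<open>k\<close> times the overflow.\<close>
    define g where "g n x = real k * min 1 (max 0 (f n x - real k))" for n x
    have g: "g n \<in> baire A" for n unfolding g_def[abs_def] using f by (intro baire_intros)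
    have g_bdd: "bdd_above (range (\<lambda>n. g n x))" for x
    proof (rule bdd_aboveI2)
      show "g n x \<le> real k * 1" for n unfolding g_def by (intro mult_left_mono) auto
    qed
    have sup: "(\<lambda>x. SUP n. g n x) \<in> baire A" by (rule baire.SUP[OF g g_bdd])
    have "real k * overflow f x \<le> (SUP n. g n x)" for x
    proof (cases "bdd_above (range (\<lambda>n. f n x))")
      case True
      have "0 \<le> g 0 x" by (simp add: g_def)
      then show ?thesis using overflow_eq_0[of f x, OF True] cSUP_upper2[OF g_bdd, of 0 0 x] by simp
    next
      case False
      then obtain n where "f n x > real k + 1" by (meson bdd_aboveI2 not_le)
      then have "g n x = real k" by (simp add: g_def)
      then show ?thesis using overflow_eq_1[of f x, OF False] cSUP_upper2[OF g_bdd, of n "real k" x] by simp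
    qed
    then have "\<theta> (q (\<lambda>x. real k * overflow f x)) \<sqsubseteq>\<^bsub>H\<^esub> \<theta> (q (\<lambda>x. SUP n. g n x))"
      using o sup by (intro hom_mono baire_nmult)
    moreover have "\<theta> (q (\<lambda>x. SUP n. g n x)) \<sqsubseteq>\<^bsub>H\<^esub> s \<squnion>\<^bsub>H\<^esub> wzero H"
    proof (rule is_lub_least[OF SUP_is_lub[OF g g_bdd]])
      show "s \<squnion>\<^bsub>H\<^esub> wzero H \<in> carrier H" using s by simp
      fix z assume "z \<in> range (\<lambda>n. \<theta> (q (g n)))"
      then obtain n where z: "z = \<theta> (q (g n))" by blast
      have m: "(\<lambda>x. max (f n x) 0) \<in> baire A" using f by (intro baire_intros)
      have "g n x \<le> max (f n x) 0" for x
      proof (cases "f n x \<le> real k")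
        case False
        then have "g n x \<le> real k * 1" unfolding g_def by (intro mult_left_mono) auto
        then show ?thesis using False by simp
      qed (simp add: g_def)
      then have "z \<sqsubseteq>\<^bsub>H\<^esub> \<theta> (q (f n)) \<squnion>\<^bsub>H\<^esub> wzero H"
        using hom_mono[OF g m, of n] f by (simp add: z hom_max hom_zero baire_zero)
      moreover have "\<theta> (q (f n)) \<squnion>\<^bsub>H\<^esub> wzero H \<sqsubseteq>\<^bsub>H\<^esub> s \<squnion>\<^bsub>H\<^esub> wzero H"
        using s hom_closed[OF f] by (intro H.join_le) (auto intro: H.le_trans[OF _ H.join_left] simp: H.join_right)
      ultimately show "z \<sqsubseteq>\<^bsub>H\<^esub> s \<squnion>\<^bsub>H\<^esub> wzero H"
        using z g f s hom_closed by (meson H.le_trans H.join_closed H.add.one_closed)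
    qed
    ultimately have "\<theta> (q (\<lambda>x. real k * overflow f x)) \<sqsubseteq>\<^bsub>H\<^esub> s \<squnion>\<^bsub>H\<^esub> wzero H"
      by (rule H.le_trans) (use hom_closed[OF baire_nmult[OF o, of k]] hom_closed[OF sup] s in auto)
    then show "\<theta> (q (overflow f)) [^]\<^bsub>add_grp H\<^esub> k \<sqsubseteq>\<^bsub>H\<^esub> s \<squnion>\<^bsub>H\<^esub> wzero H"
      using o by (simp add: hom_nmult)
  qed
  then have "q (overflow f) = q (\<lambda>x. 0)"
    by (intro inj_onD[OF inj]) (simp_all add: o hom_zero baire_zero)
  then show ?thesis using q_eq_iff[OF o baire_zero] by simp
qed

end

text \<open>Representatives of the generators of a cut are bounded above almost everywhere, by the
  extension in which the cut has a supremum. Replacing them by 0 elsewhere changes no class, and the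
  supremum of the modified sequence is preserved by all morphisms.\<close>

theorem pointwise_sigma_complete_Q: "pointwise_sigma_complete Q"
  unfolding pointwise_sigma_complete_def
proof (intro conjI allI impI W_object_Q divisible_Q)
  fix Z assume "countably_generated Q Z \<and> cut Q Z"
  then obtain K S \<theta> s where K: "countable K" "K \<subseteq> carrier Q"
    and Z: "Z = {g \<in> carrier Q. \<exists>k\<in>K. g \<sqsubseteq>\<^bsub>Q\<^esub> k}"
    and S: "W_object (S :: 'q wstruct)" and \<theta>: "\<theta> \<in> W_hom Q S" and inj: "inj_on \<theta> (carrier Q)"
    and s: "is_lub S s (\<theta> ` Z)"
    unfolding countably_generated_def cut_def W_extension_def by blast
  interpret S: W_object S by (rule S)
  have lub: "is_lub S s (\<theta> ` K)"
    using s unfolding Z Upper_image_down[OF W_object_Q S \<theta> K(2)] .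
  have sc: "s \<in> carrier S" using lub by (rule is_lub_closed)
  have "\<exists>f\<in>baire A. \<forall>(H :: 'q wstruct) \<phi>. W_object H \<longrightarrow> \<phi> \<in> W_hom Q H \<longrightarrow> is_lub H (\<phi> (q f)) (\<phi> ` K)"
  proof (cases "K = {}")
    case True
    \<comment> \<open>A supremum of the empty set is a least element, so
      \<open>n 1 \<le> - s\<close> for all \<open>n\<close>, and the unit is 0 in \<open>S\<close>.
      By injectivity it is 0 in \<open>Q\<close>, so every codomain of a morphism from
      \<open>Q\<close> is trivial.\<close>
    have "wunit S [^]\<^bsub>add_grp S\<^esub> n \<sqsubseteq>\<^bsub>S\<^esub> inv\<^bsub>add_grp S\<^esub> s" for n :: nat
    proof -
      have "s \<sqsubseteq>\<^bsub>S\<^esub> inv\<^bsub>add_grp S\<^esub> (wunit S [^]\<^bsub>add_grp S\<^esub> n)"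
        by (rule is_lub_least[OF lub]) (use True S.unit_closed in auto)
      then have "wadd S s (wunit S [^]\<^bsub>add_grp S\<^esub> n) \<sqsubseteq>\<^bsub>S\<^esub> wzero S"
        using sc S.unit_closed S.le_diff_iff[of s "wzero S" "wunit S [^]\<^bsub>add_grp S\<^esub> n"] by simp
      then show ?thesis
        using sc S.unit_closed S.le_diff_iff[of "wunit S [^]\<^bsub>add_grp S\<^esub> n" "wzero S" s]
        by (simp add: S.add.m_comm)
    qed
    then have "wunit S = wzero S"
      using sc S.unit_closed S.unit_nonneg by (intro S.archimedean[of "wunit S" "inv\<^bsub>add_grp S\<^esub> s"]) auto
    then have "\<theta> (q (\<lambda>x. 1)) = \<theta> (q (\<lambda>x. 0))" using hom_unit[OF S \<theta>] hom_zero[OF S \<theta>] by simp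
    then have eq: "q (\<lambda>x. 1) = q (\<lambda>x. 0)"
      by (rule inj_onD[OF inj]) (simp_all add: baire.one baire_zero)
    have "is_lub H (\<phi> (q (\<lambda>x. 0))) (\<phi> ` K)" if "W_object H" "\<phi> \<in> W_hom Q H"
      for H :: "'q wstruct" and \<phi>
    proof -
      interpret H: W_object H by fact
      have "wunit H = wzero H" using eq hom_unit[OF that] hom_zero[OF that] by simp
      then have "u = wzero H" if "u \<in> carrier H" for u using H.trivial_if_unit_zero that by blast
      then show ?thesis using hom_zero[OF that] by (intro is_lubI) (auto simp: True)
    qed
    then show ?thesis using baire_zero by blast
  next
    case False
    define f where "f n = rep (from_nat_into K n)" for n
    have range: "range (from_nat_into K) = K" using False K(1) by (rule range_from_nat_into)
    then have "from_nat_into K n \<in> carrier Q" for n using K(2) by blast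
    then have f: "f n \<in> baire A" and qf: "q (f n) = from_nat_into K n" for n
      by (auto simp: f_def rep_baire)
    have "eventually (\<lambda>x. overflow f x = 0) F"
    proof (rule ae_overflow_eq_0[OF S \<theta> inj f sc])
      fix n
      have "from_nat_into K n \<in> K" using range by blast
      then show "\<theta> (q (f n)) \<sqsubseteq>\<^bsub>S\<^esub> s"
        using K(2) by (intro is_lub_upper[OF lub]) (auto simp: qf intro!: W_hom_closed[OF \<theta>])
    qed
    then have ae: "eventually (\<lambda>x. (if overflow f x = 0 then f n x else 0) = f n x) F" for n
      by eventually_elim simp
    define g where "g n x = (if overflow f x = 0 then f n x else 0)" for n x
    have g: "g n \<in> baire A" for n
      unfolding g_def[abs_def] using f by (rule baire_finite_part)
    have g_bdd: "bdd_above (range (\<lambda>n. g n x))" for x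
      unfolding g_def by (rule finite_part_bdd)
    have "q (g n) = from_nat_into K n" for n
      using ae[of n] q_eq_iff[OF g f, of n n] by (simp add: g_def qf)
    then have "range (\<lambda>n. \<phi> (q (g n))) = \<phi> ` K" for \<phi> :: "'q \<Rightarrow> 'q"
      using range by (simp flip: image_image[of \<phi> "from_nat_into K"])
    then have "is_lub H (\<phi> (q (\<lambda>x. SUP n. g n x))) (\<phi> ` K)" if "W_object H" "\<phi> \<in> W_hom Q H"
      for H :: "'q wstruct" and \<phi>
      using SUP_is_lub[OF that g g_bdd] by simp
    moreover have "(\<lambda>x. SUP n. g n x) \<in> baire A" by (rule baire.SUP[OF g g_bdd])
    ultimately show ?thesis by blast
  qed
  then obtain f where f: "f \<in> baire A"
    and lub: "\<And>(H :: 'q wstruct) \<phi>. W_object H \<Longrightarrow> \<phi> \<in> W_hom Q H \<Longrightarrow> is_lub H (\<phi> (q f)) (\<phi> ` K)"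
    by blast
  have "is_lub H (\<phi> (q f)) (\<phi> ` Z)" if "W_object H" "\<phi> \<in> W_hom Q H" for H :: "'q wstruct" and \<phi>
    using lub[OF that] unfolding Z Upper_image_down[OF W_object_Q that K(2)] .
  then have "pointwise_join Q (q f) Z"
    using f Z unfolding pointwise_join_def by auto
  then show "\<exists>f. pointwise_join Q f Z" by blast
qed

end

section \<open>The reflection\<close>

definition hom_filter :: "'a wstruct \<Rightarrow> ('a \<Rightarrow> real) filter" where
  "hom_filter G = Abs_filter (\<lambda>P. \<exists>C. countable C \<and> C \<subseteq> carrier G \<and> (\<forall>x. partial_hom G C x \<longrightarrow> P x))"

lemma partial_hom_mono: "partial_hom G D x \<Longrightarrow> C \<subseteq> D \<Longrightarrow> partial_hom G C x"
  unfolding partial_hom_def by blast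

lemma eventually_hom_filter:
  "eventually P (hom_filter G) \<longleftrightarrow>
     (\<exists>C. countable C \<and> C \<subseteq> carrier G \<and> (\<forall>x. partial_hom G C x \<longrightarrow> P x))"
  unfolding hom_filter_def
proof (rule eventually_Abs_filter, rule is_filter.intro, goal_cases)
  case 1
  show ?case by (intro exI[of _ "{}"]) simp
next
  case (2 P Q)
  then obtain C D where "countable C" "C \<subseteq> carrier G" "\<forall>x. partial_hom G C x \<longrightarrow> P x"
    "countable D" "D \<subseteq> carrier G" "\<forall>x. partial_hom G D x \<longrightarrow> Q x" by auto
  then show ?case by (intro exI[of _ "C \<union> D"]) (auto intro: partial_hom_mono)
next
  case (3 P Q)
  then show ?case by blast
qed

lemma eventually_hom_filterI:
  "countable C \<Longrightarrow> C \<subseteq> carrier G \<Longrightarrow> (\<And>x. partial_hom G C x \<Longrightarrow> P x) \<Longrightarrow> eventually P (hom_filter G)"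
  unfolding eventually_hom_filter by blast

lemma hom_filter_all:
  assumes "\<And>n::nat. eventually (P n) (hom_filter G)"
  shows "eventually (\<lambda>x. \<forall>n. P n x) (hom_filter G)"
proof -
  obtain C where C: "\<forall>n. countable (C n) \<and> C n \<subseteq> carrier G \<and> (\<forall>x. partial_hom G (C n) x \<longrightarrow> P n x)"
    using assms unfolding eventually_hom_filter by metis
  show ?thesis
  proof (rule eventually_hom_filterI[of "\<Union>n. C n"])
    fix x assume "partial_hom G (\<Union>n. C n) x"
    then have "partial_hom G (C n) x" for n by (rule partial_hom_mono) blast
    then show "\<forall>n. P n x" using C by blast
  qed (use C in auto)
qed

lemma hom_filter_substitute:
  assumes f: "f \<in> W_hom G H" and "eventually P (hom_filter G)"
  shows "eventually (\<lambda>y. P (\<lambda>a. y (f a))) (hom_filter H)"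
proof -
  obtain C where C: "countable C" "C \<subseteq> carrier G" "\<And>x. partial_hom G C x \<Longrightarrow> P x"
    using assms(2) unfolding eventually_hom_filter by blast
  show ?thesis
  proof (rule eventually_hom_filterI)
    show "countable (f ` C)" "f ` C \<subseteq> carrier H" using C W_hom_closed[OF f] by auto
    fix y assume y: "partial_hom H (f ` C) y"
    have "partial_hom G C (\<lambda>a. y (f a))"
      unfolding partial_hom_def
    proof (intro conjI ballI)
      show "y (f (wunit G)) = 1" using f y by (simp add: W_hom_def partial_hom_def)
      fix a b assume "a \<in> C" "b \<in> C"
      moreover from this have "f (wadd G a b) = wadd H (f a) (f b)"
        "f (a \<squnion>\<^bsub>G\<^esub> b) = f a \<squnion>\<^bsub>H\<^esub> f b" "f (a \<sqinter>\<^bsub>G\<^esub> b) = f a \<sqinter>\<^bsub>H\<^esub> f b"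
        using f C(2) by (auto simp: W_hom_def hom_def subset_iff)
      ultimately show "y (f (wadd G a b)) = y (f a) + y (f b)"
        "y (f (a \<squnion>\<^bsub>G\<^esub> b)) = max (y (f a)) (y (f b))"
        "y (f (a \<sqinter>\<^bsub>G\<^esub> b)) = min (y (f a)) (y (f b))"
        using y by (simp_all add: partial_hom_def)
    qed
    then show "P (\<lambda>a. y (f a))" by (rule C(3))
  qed
qed

text \<open>If the conclusion fails, \<open>(a - b)^+\<close> is positive. Let \<open>D\<close>
  extend a countable set witnessing the hypothesis by the elements needed to evaluate
  \<open>(a - b)^+\<close>; a point separating it on \<open>D\<close> has \<open>x a > x b\<close>,
  a contradiction.\<close>

lemma (in W_object) ae_le_imp_le:
  assumes "a \<in> carrier G" "b \<in> carrier G" and ae: "eventually (\<lambda>x. x a \<le> x b) (hom_filter G)"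
  shows "a \<sqsubseteq> b"
proof (rule ccontr)
  assume "\<not> a \<sqsubseteq> b"
  define d where "d = a \<oplus> \<ominus> b"
  have d: "d \<in> carrier G" "d \<oplus> b = a" using assms(1,2) by (simp_all add: d_def add.m_assoc)
  have "\<not> d \<sqsubseteq> \<zero>" using \<open>\<not> a \<sqsubseteq> b\<close> assms(1,2) by (simp add: d_def diff_le_iff)
  moreover have "d \<sqsubseteq> d \<squnion> \<zero>" "\<zero> \<sqsubseteq> d \<squnion> \<zero>" using d by (simp_all add: join_left join_right)
  ultimately have p: "pos (d \<squnion> \<zero>)" using d by (auto simp: pos_def)
  obtain C where C: "countable C" "C \<subseteq> carrier G" "\<And>x. partial_hom G C x \<Longrightarrow> x a \<le> x b"
    using ae unfolding eventually_hom_filter by blast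
  define D where "D = C \<union> {a, b, d, \<zero>, d \<squnion> \<zero>}"
  have "countable D" "D \<subseteq> carrier G" "d \<squnion> \<zero> \<in> D" using C assms(1,2) d by (auto simp: D_def)
  then obtain x where x: "partial_hom G D x" "0 < x (d \<squnion> \<zero>)"
    using separating_point[OF p] by metis
  have h: "x (u \<oplus> v) = x u + x v" "x (u \<squnion> v) = max (x u) (x v)" if "u \<in> D" "v \<in> D" for u v
    using x(1) that by (simp_all add: partial_hom_def)
  have "x a = x d + x b" using h(1)[of d b] d by (simp add: D_def)
  moreover have "x \<zero> = 0" using h(1)[of \<zero> \<zero>] by (simp add: D_def)
  then have "x d > 0" using h(2)[of d \<zero>] x(2) by (simp add: D_def)
  moreover have "x a \<le> x b" using x(1) by (intro C(3)) (auto simp: D_def intro: partial_hom_mono)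
  ultimately show False by simp
qed

lemma (in W_object) ae_nmul:
  assumes a: "a \<in> carrier G"
  shows "eventually (\<lambda>x. x (n \<cdot> a) = real n * x a) (hom_filter G)"
proof (rule eventually_hom_filterI)
  show "countable (insert a (range (\<lambda>i::nat. i \<cdot> a)))" "insert a (range (\<lambda>i::nat. i \<cdot> a)) \<subseteq> carrier G"
    using a by auto
  fix x assume x: "partial_hom G (insert a (range (\<lambda>i::nat. i \<cdot> a))) x"
  have add: "x (i \<cdot> a \<oplus> b) = x (i \<cdot> a) + x b" if "b = a \<or> b = i \<cdot> a" for i :: nat and b
    using x that unfolding partial_hom_def by auto
  show "x (n \<cdot> a) = real n * x a"
  proof (induction n)
    case 0
    then show ?case using add[where i = 0 and b = "0 \<cdot> a"] by simp
  next
    case (Suc n)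
    then show ?case using add[where i = n and b = a] by (simp add: algebra_simps)
  qed
qed

text \<open>Torsion-freeness is inherited from the reals, since points detect equality.\<close>

lemma (in W_object) nmul_cancel:
  assumes "a \<in> carrier G" "b \<in> carrier G" "n \<noteq> 0" "n \<cdot> a = n \<cdot> b"
  shows "a = b"
proof -
  have "eventually (\<lambda>x. x a = x b) (hom_filter G)"
    using ae_nmul[OF assms(1), of n] ae_nmul[OF assms(2), of n]
    by eventually_elim (use assms(3,4) in simp)
  then have "eventually (\<lambda>x. x a \<le> x b) (hom_filter G)" "eventually (\<lambda>x. x b \<le> x a) (hom_filter G)"
    by (auto elim: eventually_mono)
  then show ?thesis using assms by (intro le_antisym ae_le_imp_le)
qed

text \<open>The type naming the classes is left open: sequences over the carrier type name those of
  the reflection, whereas for a test object sets of Baire functions will do.\<close>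

locale W_baire = W_object G for G :: "'a wstruct" (structure) +
  fixes q :: "(('a \<Rightarrow> real) \<Rightarrow> real) \<Rightarrow> 'q"
  assumes q_eq_iff_ae: "f \<in> baire (carrier G) \<Longrightarrow> g \<in> baire (carrier G) \<Longrightarrow>
    q f = q g \<longleftrightarrow> eventually (\<lambda>x. f x = g x) (hom_filter G)"
begin

sublocale baire_quotient "carrier G" "hom_filter G" q
  by unfold_locales (auto simp: q_eq_iff_ae hom_filter_all)

section \<open>Evaluation as the map into the quotient\<close>

definition embed :: "'a \<Rightarrow> 'q" where "embed = (\<lambda>a\<in>carrier G. q (\<lambda>x. x a))"

lemma embed_eq: "a \<in> carrier G \<Longrightarrow> embed a = q (\<lambda>x. x a)"
  by (simp add: embed_def)

lemma q_eqI:
  assumes "f \<in> baire (carrier G)" "g \<in> baire (carrier G)" "countable C" "C \<subseteq> carrier G"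
    "\<And>x. partial_hom G C x \<Longrightarrow> f x = g x"
  shows "q f = q g"
  using assms by (simp add: q_eq_iff_ae eventually_hom_filterI)

lemma embed_hom: "embed \<in> W_hom G Q"
proof -
  have "q (\<lambda>x. x (a \<oplus> b)) = q (\<lambda>x. x a + x b) \<and> q (\<lambda>x. x (a \<squnion> b)) = q (\<lambda>x. max (x a) (x b)) \<and>
      q (\<lambda>x. x (a \<sqinter> b)) = q (\<lambda>x. min (x a) (x b))" if "a \<in> carrier G" "b \<in> carrier G" for a b
    using that
    by (intro conjI q_eqI[of _ _ "{a, b}"] baire_intros baire.var) (auto simp: partial_hom_def)
  moreover have "q (\<lambda>x. x (wunit G)) = q (\<lambda>x. 1)"
    by (intro q_eqI[of _ _ "{}"] baire.intros unit_closed) (auto simp: partial_hom_def)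
  ultimately show ?thesis
    unfolding W_hom_def using unit_closed
    by (auto simp: hom_def embed_eq baire.var wunit_Q add_Q join_Q meet_Q) (simp_all add: embed_def)
qed

lemma W_extension_embed: "W_extension G Q embed"
  unfolding W_extension_def
proof (intro conjI W_object_Q embed_hom inj_onI)
  fix a b assume ab: "a \<in> carrier G" "b \<in> carrier G" "embed a = embed b"
  then have "eventually (\<lambda>x. x a = x b) (hom_filter G)"
    by (simp add: embed_eq q_eq_iff_ae baire.var)
  then have "eventually (\<lambda>x. x a \<le> x b) (hom_filter G)" "eventually (\<lambda>x. x b \<le> x a) (hom_filter G)"
    by (auto elim: eventually_mono)
  then show "a = b" using ab by (intro le_antisym ae_le_imp_le)
qed

text \<open>By induction on Baire functions, each class is the image of an element: divisibility of
  \<open>G\<close> handles quotients, and pointwise joins of countably generated cuts handle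
  suprema.\<close>

lemma embed_surj:
  assumes G: "pointwise_sigma_complete G"
  shows "embed ` carrier G = carrier Q"
proof -
  have WG: "W_object G" using G by (simp add: pointwise_sigma_complete_def)
  interpret Q: W_object Q by (rule W_object_Q)
  have hom: "embed (a \<oplus> b) = wadd Q (embed a) (embed b)" "embed (a \<squnion> b) = embed a \<squnion>\<^bsub>Q\<^esub> embed b"
    if "a \<in> carrier G" "b \<in> carrier G" for a b
    using embed_hom that by (auto simp: W_hom_def hom_def)
  have cl: "embed a \<in> carrier Q" if "a \<in> carrier G" for a using W_hom_closed[OF embed_hom that] .
  have "q b \<in> embed ` carrier G" if "b \<in> baire (carrier G)" for b
    using that
  proof induction
    case (var a)
    then show ?case by (intro image_eqI[of _ _ a]) (simp_all add: embed_eq)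
  next
    case one
    then show ?case using embed_hom unit_closed
      by (intro image_eqI[of _ _ "wunit G"]) (simp_all add: W_hom_def wunit_Q)
  next
    case (diff f g)
    then obtain a b where ab: "a \<in> carrier G" "q f = embed a" "b \<in> carrier G" "q g = embed b" by auto
    have "wadd Q (q (\<lambda>x. f x - g x)) (q g) = q f"
      using diff.hyps by (simp add: add_Q baire.diff)
    also have "\<dots> = wadd Q (embed (a \<oplus> \<ominus> b)) (q g)"
      using ab hom(1)[of "a \<oplus> \<ominus> b" b] by (simp add: add.m_assoc)
    finally have "q (\<lambda>x. f x - g x) = embed (a \<oplus> \<ominus> b)"
      using diff ab cl by (simp add: baire.diff)
    then show ?case using ab by (intro image_eqI[of _ _ "a \<oplus> \<ominus> b"]) simp_all
  next
    case (max f g)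
    then obtain a b where ab: "a \<in> carrier G" "q f = embed a" "b \<in> carrier G" "q g = embed b" by auto
    have "q (\<lambda>x. max (f x) (g x)) = embed (a \<squnion> b)"
      using max.hyps ab hom(2)[of a b] by (simp flip: join_Q)
    then show ?case using ab by (intro image_eqI[of _ _ "a \<squnion> b"]) simp_all
  next
    case (divide f n)
    then obtain a where a: "a \<in> carrier G" "q f = embed a" by auto
    show ?case
    proof (cases "n = 0")
      \<comment> \<open>Division by 0 gives the zero function.\<close>
      case True
      then show ?thesis using W_hom_zero[OF WG W_object_Q embed_hom]
        by (intro image_eqI[of _ _ \<zero>]) (simp_all add: wzero_Q)
    next
      case False
      then obtain b where b: "b \<in> carrier G" "n \<cdot> b = a"
        using G a unfolding pointwise_sigma_complete_def divisible_def by blast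
      have "embed (n \<cdot> b) = embed b [^]\<^bsub>add_grp Q\<^esub> n"
        by (rule hom_nat_pow)
          (use embed_hom b add.is_group Q.add.is_group in \<open>simp_all add: W_hom_def\<close>)
      then have "q f = q (\<lambda>x. real n * x b)" using a b by (simp add: embed_eq nat_pow_Q baire.var)
      then have "eventually (\<lambda>x. f x = real n * x b) (hom_filter G)"
        using divide b by (simp add: q_eq_iff_ae baire_nmult baire.var)
      then have "eventually (\<lambda>x. f x / real n = x b) (hom_filter G)"
        by eventually_elim (use False in simp)
      then have "q (\<lambda>x. f x / real n) = embed b"
        using divide b by (simp add: q_eq_iff_ae embed_eq baire.var baire.divide)
      then show ?thesis using b by blast
    qed
  next
    case (SUP f)
    have "\<exists>a. a \<in> carrier G \<and> embed a = q (f n)" for n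
    proof -
      from SUP.IH[of n] obtain a where "q (f n) = embed a" "a \<in> carrier G" by (rule imageE)
      then show ?thesis by (intro exI[of _ a]) simp
    qed
    then have "\<forall>n. \<exists>a. a \<in> carrier G \<and> embed a = q (f n)" by (rule allI)
    then have "\<exists>a. \<forall>n. a n \<in> carrier G \<and> embed (a n) = q (f n)" by (rule choice)
    then obtain a where a_all: "\<forall>n. a n \<in> carrier G \<and> embed (a n) = q (f n)" by (rule exE)
    then have a: "range a \<subseteq> carrier G" and ea: "embed ` range a = range (\<lambda>n. q (f n))"
      by (auto simp: image_image)
    define Z where "Z = {g \<in> carrier G. \<exists>k\<in>range a. g \<sqsubseteq> k}"
    note up = Upper_image_down[OF WG W_object_Q embed_hom a, folded Z_def]
    \<comment> \<open>The identity morphism turns \<open>SUP_is_lub\<close> into a statement about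
      suprema in \<open>Q\<close> itself.\<close>
    have "is_lub Q (restrict id (carrier Q) (q (\<lambda>x. SUP n. f n x))) (range (\<lambda>n. restrict id (carrier Q) (q (f n))))"
      by (rule SUP_is_lub[OF W_object_Q W_hom_id[OF W_object_Q] SUP.hyps])
    then have lub: "is_lub Q (q (\<lambda>x. SUP n. f n x)) (embed ` Z)"
      using SUP.hyps baire.SUP[OF SUP.hyps] by (simp add: up ea)
    have Z: "downset G Z"
      using a unfolding downset_def Z_def by (blast intro: le_trans)
    \<comment> \<open>The extension \<open>Q\<close> witnesses the cut. Its pointwise join
      \<open>s\<close> in \<open>G\<close> is then carried by \<open>embed\<close> to the supremum
      in \<open>Q\<close>, which is unique.\<close>
    have "cut G Z" by (rule cut_if_is_lub_extension[OF WG Z W_extension_embed lub])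
    moreover have "countably_generated G Z"
      unfolding countably_generated_def Z_def using a by (intro exI[of _ "range a"]) auto
    ultimately obtain s where s: "pointwise_join G s Z"
      using G unfolding pointwise_sigma_complete_def by blast
    have "is_lub Q (embed s) (embed ` Z)"
      by (rule pointwise_join_is_lub[OF WG s W_object_Q embed_hom])
    then have "q (\<lambda>x. SUP n. f n x) = embed s" using lub by (rule Q.least_unique[rotated])
    then show ?case using s by (auto simp: pointwise_join_def)
  qed
  then show ?thesis using cl by (auto simp: carrier_Q)
qed

text \<open>Induction on Baire functions: the image of each is determined by the images of its
  constituents, for quotients because \<open>H\<close> is torsion-free and for suprema by
  \<open>SUP_is_lub\<close>.\<close>

lemma hom_eqI:
  assumes H: "W_object H" and g: "g \<in> W_hom Q H" "g' \<in> W_hom Q H"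
    and eq: "\<And>a. a \<in> carrier G \<Longrightarrow> g (embed a) = g' (embed a)"
  shows "g = g'"
proof -
  interpret H: W_object H by (rule H)
  note c = hom_closed[OF H g(1)]
  have "g (q b) = g' (q b)" if "b \<in> baire (carrier G)" for b
    using that
  proof induction
    case (var a)
    then show ?case using eq[of a] by (simp add: embed_eq)
  next
    case one
    then show ?case by (simp add: hom_unit[OF H] g)
  next
    case (diff f h)
    have *: "wadd H (\<phi> (q (\<lambda>x. f x - h x))) (\<phi> (q h)) = \<phi> (q f)" if "\<phi> \<in> W_hom Q H" for \<phi>
      using hom_add[OF H that baire.diff[OF diff.hyps] diff.hyps(2)] by simp
    have "wadd H (g (q (\<lambda>x. f x - h x))) (g (q h)) = wadd H (g' (q (\<lambda>x. f x - h x))) (g (q h))"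
      using *[OF g(1)] *[OF g(2)] diff.IH by simp
    then show ?case
      using hom_closed[OF H g(1)] hom_closed[OF H g(2)] diff.hyps by (simp add: baire.diff)
  next
    case (max f h)
    then show ?case by (simp add: hom_max[OF H] g)
  next
    case (divide f n)
    show ?case
    proof (cases "n = 0")
      case True
      then show ?thesis by (simp add: hom_zero[OF H] g)
    next
      case False
      have *: "\<phi> (q (\<lambda>x. f x / real n)) [^]\<^bsub>add_grp H\<^esub> n = \<phi> (q f)" if "\<phi> \<in> W_hom Q H" for \<phi>
        using hom_nmult[OF H that baire.divide[OF divide.hyps], of n n] False by simp
      note b = baire.divide[OF divide.hyps, of n]
      show ?thesis
        by (rule H.nmul_cancel[OF hom_closed[OF H g(1) b] hom_closed[OF H g(2) b] False])
          (simp only: *[OF g(1)] *[OF g(2)] divide.IH)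
    qed
  next
    case (SUP f)
    have "is_lub H (\<phi> (q (\<lambda>x. SUP n. f n x))) (range (\<lambda>n. \<phi> (q (f n))))" if "\<phi> \<in> W_hom Q H" for \<phi>
      by (rule SUP_is_lub[OF H that SUP.hyps])
    from this[OF g(1)] this[OF g(2)] show ?case
      using SUP.IH by (auto intro: H.least_unique)
  qed
  then have "g z = g' z" if "z \<in> carrier Q" for z using that by (auto simp: carrier_Q)
  then show ?thesis using g by (intro extensionalityI[of _ "carrier Q"]) (auto simp: W_hom_def)
qed

end

section \<open>Functoriality and the universal property\<close>

lemma induced_hom:
  assumes "W_baire G q" "W_baire H p" and f: "f \<in> W_hom G H"
  obtains m where "m \<in> W_hom (baire_quotient.Q (carrier G) (hom_filter G) q)
      (baire_quotient.Q (carrier H) (hom_filter H) p)"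
    "\<And>a. a \<in> carrier G \<Longrightarrow> m (W_baire.embed G q a) = W_baire.embed H p (f a)"
proof -
  interpret G: W_baire G q by fact
  interpret H: W_baire H p by fact
  \<comment> \<open>Composition with \<open>f\<close> sends points of \<open>H\<close> to points of
    \<open>G\<close>; dually, \<open>t\<close> sends Baire functions on the latter to Baire
    functions on the former, and it respects almost everywhere equality by
    \<open>hom_filter_substitute\<close>.\<close>
  define t where "t b = (\<lambda>y. b (\<lambda>a. y (f a)))" for b :: "('a \<Rightarrow> real) \<Rightarrow> real"
  define m where "m = (\<lambda>z\<in>carrier G.Q. p (t (G.rep z)))"
  have t: "t b \<in> baire (carrier H)" if "b \<in> baire (carrier G)" for b
    unfolding t_def using W_hom_closed[OF f] by (intro baire_substitute[OF that]) auto
  have m: "m (q b) = p (t b)" if b: "b \<in> baire (carrier G)" for b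
  proof -
    have "eventually (\<lambda>y. t (G.rep (q b)) y = t b y) (hom_filter H)"
      unfolding t_def using G.ae_rep[OF b] by (rule hom_filter_substitute[OF f])
    then show ?thesis using b by (simp add: m_def H.q_eq_iff_ae t G.rep_baire)
  qed
  show thesis
  proof
    show "m \<in> W_hom G.Q H.Q"
      unfolding W_hom_def
    proof (intro CollectI IntI conjI ballI homI)
      show "m \<in> extensional (carrier G.Q)" by (simp add: m_def)
      show "m (wunit G.Q) = wunit H.Q" by (simp add: G.wunit_Q H.wunit_Q m baire.one) (simp add: t_def)
    next
      fix z assume "z \<in> carrier (add_grp G.Q)"
      then show "m z \<in> carrier (add_grp H.Q)" by (auto elim!: G.Q_cases simp: m t)
    next
      fix z w assume "z \<in> carrier (add_grp G.Q)" "w \<in> carrier (add_grp G.Q)"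
      then obtain b c where bc: "b \<in> baire (carrier G)" "z = q b" "c \<in> baire (carrier G)" "w = q c"
        by (auto elim!: G.Q_cases)
      then show "m (z \<otimes>\<^bsub>add_grp G.Q\<^esub> w) = m z \<otimes>\<^bsub>add_grp H.Q\<^esub> m w"
        by (simp add: G.add_Q H.add_Q m t baire_add) (simp add: t_def)
    next
      fix z w assume "z \<in> carrier G.Q" "w \<in> carrier G.Q"
      then obtain b c where bc: "b \<in> baire (carrier G)" "z = q b" "c \<in> baire (carrier G)" "w = q c"
        by (auto elim!: G.Q_cases)
      then show "m (z \<squnion>\<^bsub>G.Q\<^esub> w) = m z \<squnion>\<^bsub>H.Q\<^esub> m w" "m (z \<sqinter>\<^bsub>G.Q\<^esub> w) = m z \<sqinter>\<^bsub>H.Q\<^esub> m w"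
        by (simp_all add: G.join_Q H.join_Q G.meet_Q H.meet_Q m t baire_min baire.max) (simp_all add: t_def)
    qed
    fix a assume "a \<in> carrier G"
    then show "m (G.embed a) = H.embed (f a)"
      using W_hom_closed[OF f] by (simp add: G.embed_eq H.embed_eq m baire.var) (simp add: t_def)
  qed
qed

lemma W_hom_inverse:
  assumes G: "W_object G" and e: "e \<in> W_hom G H" "inj_on e (carrier G)" "e ` carrier G = carrier H"
  shows "(\<lambda>z\<in>carrier H. inv_into (carrier G) e z) \<in> W_hom H G"
proof -
  interpret G: W_object G by (rule G)
  define i where "i = (\<lambda>z\<in>carrier H. inv_into (carrier G) e z)"
  have i: "i (e a) = a" if "a \<in> carrier G" for a
    using that e W_hom_closed[OF e(1) that] by (simp add: i_def)
  have hom: "wadd H (e a) (e b) = e (wadd G a b)" "e a \<squnion>\<^bsub>H\<^esub> e b = e (a \<squnion>\<^bsub>G\<^esub> b)" "e a \<sqinter>\<^bsub>H\<^esub> e b = e (a \<sqinter>\<^bsub>G\<^esub> b)"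
    if "a \<in> carrier G" "b \<in> carrier G" for a b
    using e(1) that by (auto simp: W_hom_def hom_def)
  have "wunit H = e (wunit G)" "i \<in> extensional (carrier H)" using e(1) by (simp_all add: W_hom_def i_def)
  then have "i \<in> W_hom H G"
    unfolding W_hom_def using G.unit_closed by (auto simp: hom_def i hom simp flip: e(3))
  then show ?thesis by (simp only: i_def)
qed

lemma W_hom_compose:
  assumes G: "W_object G" and f: "f \<in> W_hom G H" and g: "g \<in> W_hom H L"
  shows "compose (carrier G) g f \<in> W_hom G L"
proof -
  interpret G: W_object G by (rule G)
  show ?thesis
    using f g G.unit_closed
    by (auto simp: W_hom_def hom_def compose_def Pi_iff)
qed

text \<open>The morphism \<open>f\<close> lifts to the quotients of \<open>G\<close> and
  \<open>H\<close>, and for pointwise \<open>\<sigma>\<close>-complete \<open>H\<close> the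
  evaluation into its quotient is bijective and can be inverted. Uniqueness is
  \<open>hom_eqI\<close>.\<close>

lemma W_baire_reflection:
  fixes G :: "'a wstruct" and q :: "(('a \<Rightarrow> real) \<Rightarrow> real) \<Rightarrow> 'q"
  assumes "W_baire G q"
  shows "is_reflection TYPE('h) G (baire_quotient.Q (carrier G) (hom_filter G) q) (W_baire.embed G q)"
proof -
  interpret G: W_baire G q by fact
  show ?thesis
    unfolding is_reflection_def
  proof (intro conjI allI impI ballI G.pointwise_sigma_complete_Q G.embed_hom)
    fix H :: "'h wstruct" and f
    assume psc: "pointwise_sigma_complete H" and f: "f \<in> W_hom G H"
    have H: "W_object H" using psc by (simp add: pointwise_sigma_complete_def)
    \<comment> \<open>The quotient of \<open>H\<close> is auxiliary, so its elements may simply be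
      the equivalence classes themselves.\<close>
    define p where "p b = {c \<in> baire (carrier H). eventually (\<lambda>x. c x = b x) (hom_filter H)}" for b
    have "W_baire H p"
    proof (intro W_baire.intro W_baire_axioms.intro H)
      fix b c assume bc: "b \<in> baire (carrier H)" "c \<in> baire (carrier H)"
      show "p b = p c \<longleftrightarrow> eventually (\<lambda>x. b x = c x) (hom_filter H)"
      proof
        assume "p b = p c"
        moreover have "b \<in> p b" using bc by (simp add: p_def)
        ultimately have "b \<in> p c" by simp
        then show "eventually (\<lambda>x. b x = c x) (hom_filter H)" by (simp add: p_def)
      next
        assume "eventually (\<lambda>x. b x = c x) (hom_filter H)"
        then have "eventually (\<lambda>x. d x = b x \<longleftrightarrow> d x = c x) (hom_filter H)" for d
          by eventually_elim simp
        then have "eventually (\<lambda>x. d x = b x) (hom_filter H) \<longleftrightarrow> eventually (\<lambda>x. d x = c x) (hom_filter H)" for d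
          by (rule eventually_subst)
        then show "p b = p c" by (simp add: p_def)
      qed
    qed
    then interpret H: W_baire H p .
    obtain m where m: "m \<in> W_hom G.Q H.Q" "\<And>a. a \<in> carrier G \<Longrightarrow> m (G.embed a) = H.embed (f a)"
      using induced_hom[OF \<open>W_baire G q\<close> \<open>W_baire H p\<close> f] by metis
    define i where "i = (\<lambda>z\<in>carrier H.Q. inv_into (carrier H) H.embed z)"
    have inj: "inj_on H.embed (carrier H)" using H.W_extension_embed by (simp add: W_extension_def)
    have i: "i \<in> W_hom H.Q H"
      unfolding i_def by (intro W_hom_inverse H H.W_object_Q H.embed_hom inj H.embed_surj psc)
    have i_embed: "i (H.embed a) = a" if "a \<in> carrier H" for a
      using that inj W_hom_closed[OF H.embed_hom that] by (simp add: i_def)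
    let ?g = "compose (carrier G.Q) i m"
    have g: "?g \<in> W_hom G.Q H" by (rule W_hom_compose[OF G.W_object_Q m(1) i])
    show "\<exists>!g. g \<in> W_hom G.Q H \<and> compose (carrier G) g G.embed = f"
    proof (rule ex1I[of _ ?g])
      have "compose (carrier G) ?g G.embed a = f a" for a
      proof (cases "a \<in> carrier G")
        case True
        then show ?thesis
          using W_hom_closed[OF G.embed_hom True] W_hom_closed[OF f True] m(2)[OF True] i_embed
          by (simp add: compose_eq)
      next
        case False
        then show ?thesis using f by (simp add: compose_def W_hom_def extensional_def)
      qed
      with g show "?g \<in> W_hom G.Q H \<and> compose (carrier G) ?g G.embed = f" by blast
      fix g' assume g': "g' \<in> W_hom G.Q H \<and> compose (carrier G) g' G.embed = f"
      show "g' = ?g"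
      proof (rule G.hom_eqI[OF H _ g])
        show "g' \<in> W_hom G.Q H" using g' by blast
        fix a assume "a \<in> carrier G"
        then show "g' (G.embed a) = ?g (G.embed a)"
          using g' \<open>compose (carrier G) ?g G.embed a = f a\<close> by (metis compose_eq)
      qed
    qed
  qed
qed

section \<open>Naming the classes by sequences\<close>

lemma ex_W_baire:
  fixes G :: "'a wstruct"
  assumes G: "W_object G"
  obtains q :: "(('a \<Rightarrow> real) \<Rightarrow> real) \<Rightarrow> (nat \<Rightarrow> 'a)" where "W_baire G q"
proof -
  interpret G: W_object G by (rule G)
  have "\<exists>q :: (('a \<Rightarrow> real) \<Rightarrow> real) \<Rightarrow> (nat \<Rightarrow> 'a). \<forall>f\<in>baire (carrier G). \<forall>g\<in>baire (carrier G).
      q f = q g \<longleftrightarrow> eventually (\<lambda>x. f x = g x) (hom_filter G)"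
  proof (cases "carrier G = {wzero G}")
    case True
    then have "wunit G = wzero G" using G.unit_closed by simp
    \<comment> \<open>The equations at the element 0, which is also the unit, would make its value
      both 0 and 1. So there are no points and all classes coincide.\<close>
    then have False if "partial_hom G {wzero G} x" for x
      using that by (auto simp: partial_hom_def)
    then have "eventually P (hom_filter G)" for P
      by (intro eventually_hom_filterI[of "{wzero G}"]) auto
    then show ?thesis by (intro exI[of _ "\<lambda>_ _. wzero G"]) simp
  next
    case False
    then have "\<not> carrier G \<subseteq> {wzero G}"
      using G.add.one_closed by (auto simp: subset_singleton_iff)
    then obtain \<beta> where "\<beta> \<in> carrier G" "\<beta> \<noteq> wzero G" by (auto simp: subset_eq)
    then have "wzero G \<noteq> \<beta>" by simp
    then obtain e :: "(('a \<Rightarrow> real) \<Rightarrow> real) \<Rightarrow> nat \<Rightarrow> 'a" where e: "inj_on e (baire (carrier G))"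
      by (rule baire_inj)
    \<comment> \<open>A canonical representative: functions equal almost everywhere define the same
      predicate under \<open>SOME\<close>, hence the same choice. Composing with the injection
      \<open>e\<close> then names the classes.\<close>
    define r where "r f = (SOME g. g \<in> baire (carrier G) \<and> eventually (\<lambda>x. g x = f x) (hom_filter G))"
      for f :: "('a \<Rightarrow> real) \<Rightarrow> real"
    have r: "r f \<in> baire (carrier G) \<and> eventually (\<lambda>x. r f x = f x) (hom_filter G)"
      if "f \<in> baire (carrier G)" for f
      unfolding r_def by (rule someI[of _ f]) (use that in simp)
    have "e (r f) = e (r g) \<longleftrightarrow> eventually (\<lambda>x. f x = g x) (hom_filter G)"
      if fg: "f \<in> baire (carrier G)" "g \<in> baire (carrier G)" for f g
    proof
      assume "e (r f) = e (r g)"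
      then have eq: "r f = r g" using e r fg by (auto simp: inj_on_def)
      from r[OF fg(1)] r[OF fg(2)] have "eventually (\<lambda>x. r f x = f x) (hom_filter G)"
        "eventually (\<lambda>x. r f x = g x) (hom_filter G)" by (simp_all add: eq)
      then show "eventually (\<lambda>x. f x = g x) (hom_filter G)" by eventually_elim simp
    next
      assume "eventually (\<lambda>x. f x = g x) (hom_filter G)"
      then have "eventually (\<lambda>x. h x = f x \<longleftrightarrow> h x = g x) (hom_filter G)" for h
        by eventually_elim simp
      then have "eventually (\<lambda>x. h x = f x) (hom_filter G) \<longleftrightarrow> eventually (\<lambda>x. h x = g x) (hom_filter G)" for h
        by (rule eventually_subst)
      then show "e (r f) = e (r g)" by (simp add: r_def)
    qed
    then show ?thesis by (intro exI[of _ "\<lambda>f. e (r f)"]) blast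
  qed
  then obtain q :: "(('a \<Rightarrow> real) \<Rightarrow> real) \<Rightarrow> (nat \<Rightarrow> 'a)" where q: "\<forall>f\<in>baire (carrier G). \<forall>g\<in>baire (carrier G).
      q f = q g \<longleftrightarrow> eventually (\<lambda>x. f x = g x) (hom_filter G)" by (rule exE)
  have "W_baire G q"
    by (intro W_baire.intro W_baire_axioms.intro G) (use q in blast)
  then show ?thesis by (rule that)
qed

theorem corollary7p3p4:
  fixes G :: "'a wstruct"
  assumes "W_object G"
  shows "\<exists>(R :: (nat \<Rightarrow> 'a) wstruct) r.
           is_reflection TYPE(nat \<Rightarrow> 'a) G R r \<and> is_reflection TYPE('h) G R r"
proof -
  obtain q :: "(('a \<Rightarrow> real) \<Rightarrow> real) \<Rightarrow> (nat \<Rightarrow> 'a)" where q: "W_baire G q"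
    using ex_W_baire[OF assms] .
  \<comment> \<open>The choice of \<open>q\<close> does not involve the test objects, so one pair
    serves both types.\<close>
  show ?thesis
    using W_baire_reflection[OF q, where ?'h = "nat \<Rightarrow> 'a"] W_baire_reflection[OF q, where ?'h = 'h]
    by blast
qed

end
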